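(* For every $n\ge 3$, the group homomorphism $L_n: W(\tilde B_n)\to W(\tilde B_{n+1})$ defined by $\sigma_i\mapsto\sigma_i$ for $1\le i\le n-1$, $\sigma_{\bar 1}\mapsto \sigma_{\bar 1}$, $t_n\mapsto \sigma_n t_{n+1}\sigma_n$ is injective. For every $n\ge 4$, the group homomorphism $G_n: W(\tilde D_n)\to W(\tilde D_{n+1})$ defined by $\sigma_i\mapsto\sigma_i$ for $1\le i\le n-1$, $\sigma_{\bar 1}\mapsto\sigma_{\bar 1}$, $\sigma_{\overline{n-1}}\mapsto \sigma_n\sigma_{n-1}\sigma_{\bar n}\sigma_{n-1}\sigma_n$ is injective.
   Context: For $m\ge 3$, $W(\tilde B_m)$ is the Coxeter group with the $m+1$ generators $\sigma_1,\sigma_{\bar 1},\sigma_2,\dots,\sigma_{m-1},t_m$, where $\sigma_i\sigma_{i+1}$ has order 3 for $1\le i\le m-2$, $\sigma_{\bar 1}\sigma_2$ has order 3, $\sigma_{m-1}t_m$ has order 4, and all other pairs of distinct generators commute. For $m\ge 4$, $W(\tilde D_m)$ is the Coxeter group with the $m+1$ generators $\sigma_1,\sigma_{\bar 1},\sigma_2,\dots,\sigma_{m-1},\sigma_{\overline{m-1}}$, where $\sigma_i\sigma_{i+1}$ has order 3 for $1\le i\le m-2$, $\sigma_{\bar 1}\sigma_2$ has order 3, $\sigma_{m-2}\sigma_{\overline{m-1}}$ has order 3, and all other pairs of distinct generators commute (here $\bar 1$ and $\overline{m-1}$ are just labels). The formulas given for $L_n$ and $G_n$ define group homomorphisms. 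*)

theory Defs
  imports "HOL-Algebra.Group"
begin

section \<open>Groups given by generators and relators\<close>

text \<open>The letter \<open>(True, a)\<close> stands for the generator \<open>a\<close> and \<open>(False, a)\<close> for its formal inverse.\<close>

type_synonym 'a word = "(bool \<times> 'a) list"

definition words :: "'a set \<Rightarrow> 'a word set" where
  "words S = lists (UNIV \<times> S)"

inductive pres_eq :: "'a set \<Rightarrow> 'a word set \<Rightarrow> 'a word \<Rightarrow> 'a word \<Rightarrow> bool"
  for S R where
  refl: "w \<in> words S \<Longrightarrow> pres_eq S R w w"
| sym: "pres_eq S R v w \<Longrightarrow> pres_eq S R w v"
| trans: "pres_eq S R u v \<Longrightarrow> pres_eq S R v w \<Longrightarrow> pres_eq S R u w"
| cancel: "u \<in> words S \<Longrightarrow> v \<in> words S \<Longrightarrow> a \<in> S \<Longrightarrow>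
    pres_eq S R (u @ [(e, a), (\<not> e, a)] @ v) (u @ v)"
| relator: "u \<in> words S \<Longrightarrow> v \<in> words S \<Longrightarrow> r \<in> R \<Longrightarrow> r \<in> words S \<Longrightarrow>
    pres_eq S R (u @ r @ v) (u @ v)"

definition pres_rel :: "'a set \<Rightarrow> 'a word set \<Rightarrow> 'a word rel" where
  "pres_rel S R = {(v, w). pres_eq S R v w}"

definition presented_group :: "'a set \<Rightarrow> 'a word set \<Rightarrow> 'a word set monoid" where
  "presented_group S R =
     \<lparr>carrier = words S // pres_rel S R,
      mult = (\<lambda>X Y. pres_rel S R `` {x @ y | x y. x \<in> X \<and> y \<in> Y}),
      one = pres_rel S R `` {[]}\<rparr>"

definition pres_gen :: "'a set \<Rightarrow> 'a word set \<Rightarrow> 'a \<Rightarrow> 'a word set" where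
  "pres_gen S R a = pres_rel S R `` {[(True, a)]}"

fun word_eval :: "('b, 'c) monoid_scheme \<Rightarrow> ('a \<Rightarrow> 'b) \<Rightarrow> 'a word \<Rightarrow> 'b" where
  "word_eval H f [] = \<one>\<^bsub>H\<^esub>"
| "word_eval H f ((e, a) # w) = (if e then f a else inv\<^bsub>H\<^esub> (f a)) \<otimes>\<^bsub>H\<^esub> word_eval H f w"

text \<open>The map on a presented group determined by the images \<open>f\<close> of the generators. All words in
  a class \<open>X\<close> have the same value in \<open>H\<close> when \<open>f\<close> respects the relators; see
  \<open>pres_lift_hom\<close>, \<open>pres_lift_gen\<close> and \<open>pres_lift_unique\<close> below.\<close>

definition pres_lift :: "('b, 'c) monoid_scheme \<Rightarrow> ('a \<Rightarrow> 'b) \<Rightarrow> 'a word set \<Rightarrow> 'b" where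
  "pres_lift H f X = the_elem (word_eval H f ` X)"

lemma words_Nil [simp]: "[] \<in> words S"
  and words_Cons [simp]: "x # w \<in> words S \<longleftrightarrow> snd x \<in> S \<and> w \<in> words S"
  and words_append [simp]: "v @ w \<in> words S \<longleftrightarrow> v \<in> words S \<and> w \<in> words S"
  by (auto simp: words_def mem_Times_iff)

lemma pres_eq_words: "pres_eq S R v w \<Longrightarrow> v \<in> words S \<and> w \<in> words S"
  by (induction rule: pres_eq.induct) auto

lemma pres_rel_equiv: "equiv (words S) (pres_rel S R)"
proof (rule equivI)
  show "pres_rel S R \<subseteq> words S \<times> words S"
    using pres_eq_words by (fastforce simp: pres_rel_def)
  show "refl_on (words S) (pres_rel S R)"
    by (simp add: pres_rel_def refl_on_def pres_eq.refl)
  show "sym (pres_rel S R)"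
    using pres_eq.sym by (auto simp: pres_rel_def sym_def)
  show "trans (pres_rel S R)"
    unfolding pres_rel_def trans_def using pres_eq.trans by blast
qed

lemma pres_eq_append_right:
  assumes "pres_eq S R v w" "x \<in> words S" shows "pres_eq S R (v @ x) (w @ x)"
  using assms
proof (induction rule: pres_eq.induct)
  case (cancel u v a e)
  then show ?case using pres_eq.cancel[of u S "v @ x" a R e] by simp
next
  case (relator u v r)
  then show ?case using pres_eq.relator[of u S "v @ x" r R] by simp
next
  case (sym v w)
  then show ?case by (simp add: pres_eq.sym)
next
  case (trans u v w)
  then show ?case using pres_eq.trans by metis
qed (simp add: pres_eq.refl)

lemma pres_eq_append_left:
  assumes "pres_eq S R v w" "x \<in> words S" shows "pres_eq S R (x @ v) (x @ w)"
  using assms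
proof (induction rule: pres_eq.induct)
  case (cancel u v a e)
  then show ?case using pres_eq.cancel[of "x @ u" S v a R e] by simp
next
  case (relator u v r)
  then show ?case using pres_eq.relator[of "x @ u" S v r R] by simp
next
  case (sym v w)
  then show ?case by (simp add: pres_eq.sym)
next
  case (trans u v w)
  then show ?case using pres_eq.trans by metis
qed (simp add: pres_eq.refl)

lemma pres_eq_append:
  assumes "pres_eq S R v v'" "pres_eq S R w w'" shows "pres_eq S R (v @ w) (v' @ w')"
  using assms pres_eq_append_left pres_eq_append_right pres_eq.trans pres_eq_words by metis

lemma pres_class_eq_iff:
  assumes "v \<in> words S" "w \<in> words S"
  shows "pres_rel S R `` {v} = pres_rel S R `` {w} \<longleftrightarrow> pres_eq S R v w"
  using eq_equiv_class_iff[OF pres_rel_equiv assms] by (simp add: pres_rel_def)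

lemma presented_group_mult_class:
  assumes "v \<in> words S" "w \<in> words S"
  shows "pres_rel S R `` {v} \<otimes>\<^bsub>presented_group S R\<^esub> pres_rel S R `` {w} = pres_rel S R `` {v @ w}"
proof -
  let ?U = "{x @ y | x y. x \<in> pres_rel S R `` {v} \<and> y \<in> pres_rel S R `` {w}}"
  have "(v @ w, u) \<in> pres_rel S R" if "u \<in> ?U" for u
    using that pres_eq_append by (fastforce simp: pres_rel_def)
  moreover have "v @ w \<in> ?U"
    using assms by (auto simp: pres_rel_def intro: pres_eq.refl)
  moreover have "trans (pres_rel S R)"
    using pres_rel_equiv by (rule equivE)
  ultimately have "pres_rel S R `` ?U = pres_rel S R `` {v @ w}"
    by (blast dest: transD)
  then show ?thesis by (simp add: presented_group_def)
qed

lemma presented_group_carrier_cases: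
  assumes "X \<in> carrier (presented_group S R)"
  obtains w where "w \<in> words S" "X = pres_rel S R `` {w}"
  using assms by (auto simp: presented_group_def elim: quotientE)

lemma presented_group_class_closed:
  "w \<in> words S \<Longrightarrow> pres_rel S R `` {w} \<in> carrier (presented_group S R)"
  by (auto simp: presented_group_def intro: quotientI)

lemma presented_group_one: "\<one>\<^bsub>presented_group S R\<^esub> = pres_rel S R `` {[]}"
  by (simp add: presented_group_def)

lemma word_inverse:
  assumes "w \<in> words S"
  shows "\<exists>w' \<in> words S. pres_eq S R (w' @ w) []"
  using assms
proof (induction w)
  case Nil
  then show ?case by (auto intro!: bexI[of _ "[]"] pres_eq.refl)
next
  case (Cons x w)
  obtain e a where x: "x = (e, a)" by force
  with Cons obtain w' where w': "w' \<in> words S" "pres_eq S R (w' @ w) []" and a: "a \<in> S" by auto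
  have "pres_eq S R (w' @ [(\<not> e, a), (\<not> (\<not> e), a)] @ w) (w' @ w)"
    using Cons.prems w' a by (intro pres_eq.cancel) auto
  then have "pres_eq S R ((w' @ [(\<not> e, a)]) @ x # w) []"
    using pres_eq.trans[OF _ w'(2)] x by simp
  with w' a show ?case by (intro bexI[of _ "w' @ [(\<not> e, a)]"]) auto
qed

lemma group_presented_group: "group (presented_group S R)"
proof (rule groupI)
  fix X Y assume "X \<in> carrier (presented_group S R)" "Y \<in> carrier (presented_group S R)"
  then show "X \<otimes>\<^bsub>presented_group S R\<^esub> Y \<in> carrier (presented_group S R)"
    by (elim presented_group_carrier_cases)
       (simp add: presented_group_mult_class presented_group_class_closed)
next
  show "\<one>\<^bsub>presented_group S R\<^esub> \<in> carrier (presented_group S R)"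
    by (simp add: presented_group_one presented_group_class_closed)
next
  fix X Y Z
  assume "X \<in> carrier (presented_group S R)" "Y \<in> carrier (presented_group S R)"
    "Z \<in> carrier (presented_group S R)"
  then show "X \<otimes>\<^bsub>presented_group S R\<^esub> Y \<otimes>\<^bsub>presented_group S R\<^esub> Z =
    X \<otimes>\<^bsub>presented_group S R\<^esub> (Y \<otimes>\<^bsub>presented_group S R\<^esub> Z)"
    by (elim presented_group_carrier_cases) (simp add: presented_group_mult_class)
next
  fix X assume "X \<in> carrier (presented_group S R)"
  then show "\<one>\<^bsub>presented_group S R\<^esub> \<otimes>\<^bsub>presented_group S R\<^esub> X = X"
    by (elim presented_group_carrier_cases)
       (simp add: presented_group_mult_class presented_group_one)
next
  fix X assume "X \<in> carrier (presented_group S R)"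
  then obtain w where w: "w \<in> words S" "X = pres_rel S R `` {w}"
    by (rule presented_group_carrier_cases)
  then obtain w' where w': "w' \<in> words S" "pres_eq S R (w' @ w) []"
    using word_inverse[OF w(1), of R] by auto
  then have "pres_rel S R `` {w' @ w} = pres_rel S R `` {[]}"
    using w(1) pres_class_eq_iff[of "w' @ w" S "[]" R] by simp
  then have "pres_rel S R `` {w'} \<otimes>\<^bsub>presented_group S R\<^esub> X = \<one>\<^bsub>presented_group S R\<^esub>"
    using w w'(1) by (simp add: presented_group_mult_class presented_group_one)
  then show "\<exists>Y\<in>carrier (presented_group S R).
      Y \<otimes>\<^bsub>presented_group S R\<^esub> X = \<one>\<^bsub>presented_group S R\<^esub>"
    using presented_group_class_closed[OF w'(1)] by blast
qed

lemma pres_gen_closed: "a \<in> S \<Longrightarrow> pres_gen S R a \<in> carrier (presented_group S R)"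
  by (simp add: pres_gen_def presented_group_class_closed)

context
  fixes H :: "('b, 'c) monoid_scheme" and f :: "'a \<Rightarrow> 'b" and S :: "'a set"
  assumes H: "group H" and f: "f \<in> S \<rightarrow> carrier H"
begin

interpretation group H by (rule H)

lemma word_eval_closed: "w \<in> words S \<Longrightarrow> word_eval H f w \<in> carrier H"
  using f by (induction w) (auto simp: Pi_iff)

lemma word_eval_append:
  "v \<in> words S \<Longrightarrow> w \<in> words S \<Longrightarrow>
    word_eval H f (v @ w) = word_eval H f v \<otimes>\<^bsub>H\<^esub> word_eval H f w"
  using f by (induction v) (auto simp: Pi_iff word_eval_closed m_assoc)

lemma word_eval_pres_eq:
  assumes "\<And>r. r \<in> R \<Longrightarrow> word_eval H f r = \<one>\<^bsub>H\<^esub>" and "pres_eq S R v w"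
  shows "word_eval H f v = word_eval H f w"
  using assms(2)
proof (induction rule: pres_eq.induct)
  case (cancel u v a e)
  then have "f a \<in> carrier H" using f by auto
  then have "word_eval H f [(e, a), (\<not> e, a)] = \<one>\<^bsub>H\<^esub>" by simp
  with cancel show ?case
    by (simp add: word_eval_append word_eval_closed del: word_eval.simps append_Cons append_Nil)
next
  case (relator u v r)
  with assms(1) show ?case by (simp add: word_eval_append word_eval_closed)
qed simp_all

lemma pres_lift_class:
  assumes "\<And>r. r \<in> R \<Longrightarrow> word_eval H f r = \<one>\<^bsub>H\<^esub>" and "w \<in> words S"
  shows "pres_lift H f (pres_rel S R `` {w}) = word_eval H f w"
proof -
  have "word_eval H f v = word_eval H f w" if "v \<in> pres_rel S R `` {w}" for v
    using word_eval_pres_eq[OF assms(1), of R w v] that by (simp add: pres_rel_def)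
  moreover have "w \<in> pres_rel S R `` {w}"
    using assms(2) by (simp add: pres_rel_def pres_eq.refl)
  ultimately have "word_eval H f ` (pres_rel S R `` {w}) = {word_eval H f w}"
    by blast
  then show ?thesis by (simp add: pres_lift_def)
qed

theorem pres_lift_hom:
  assumes "\<And>r. r \<in> R \<Longrightarrow> word_eval H f r = \<one>\<^bsub>H\<^esub>"
  shows "pres_lift H f \<in> hom (presented_group S R) H"
proof (rule homI)
  fix X assume "X \<in> carrier (presented_group S R)"
  then show "pres_lift H f X \<in> carrier H"
    by (elim presented_group_carrier_cases) (simp add: pres_lift_class assms word_eval_closed)
next
  fix X Y assume "X \<in> carrier (presented_group S R)" "Y \<in> carrier (presented_group S R)"
  then show "pres_lift H f (X \<otimes>\<^bsub>presented_group S R\<^esub> Y) = pres_lift H f X \<otimes>\<^bsub>H\<^esub> pres_lift H f Y"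
    by (elim presented_group_carrier_cases)
       (simp add: pres_lift_class assms word_eval_append presented_group_mult_class)
qed

theorem pres_lift_gen:
  assumes "\<And>r. r \<in> R \<Longrightarrow> word_eval H f r = \<one>\<^bsub>H\<^esub>" and "a \<in> S"
  shows "pres_lift H f (pres_gen S R a) = f a"
  using assms f pres_lift_class[of R "[(True, a)]"] by (auto simp: pres_gen_def Pi_iff)

theorem pres_lift_unique:
  assumes "\<And>r. r \<in> R \<Longrightarrow> word_eval H f r = \<one>\<^bsub>H\<^esub>"
    and h: "h \<in> hom (presented_group S R) H" "\<And>a. a \<in> S \<Longrightarrow> h (pres_gen S R a) = f a"
    and X: "X \<in> carrier (presented_group S R)"
  shows "h X = pres_lift H f X"
proof -
  interpret P: group "presented_group S R" by (rule group_presented_group)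
  interpret h: group_hom "presented_group S R" H h
    using h(1) by unfold_locales
  have "h (pres_rel S R `` {w}) = word_eval H f w" if "w \<in> words S" for w
    using that
  proof (induction w)
    case Nil
    then show ?case using h.hom_one by (simp add: presented_group_one)
  next
    case (Cons x w)
    obtain e a where x: "x = (e, a)" by force
    with Cons.prems have a: "a \<in> S" and w: "w \<in> words S" by auto
    have pos: "h (pres_rel S R `` {[(True, a)]}) = f a"
      using h(2)[OF a] by (simp add: pres_gen_def)
    have "pres_eq S R ([] @ [(False, a), (\<not> False, a)] @ []) ([] @ [])"
      using a by (intro pres_eq.cancel) auto
    then have "pres_rel S R `` {[(False, a)]} \<otimes>\<^bsub>presented_group S R\<^esub> pres_gen S R a
        = \<one>\<^bsub>presented_group S R\<^esub>"
      using a by (simp add: pres_gen_def presented_group_mult_class presented_group_one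
          pres_class_eq_iff)
    then have "pres_rel S R `` {[(False, a)]} = inv\<^bsub>presented_group S R\<^esub> (pres_gen S R a)"
      using a by (intro P.inv_equality[symmetric])
        (auto simp: pres_gen_closed presented_group_class_closed)
    then have neg: "h (pres_rel S R `` {[(False, a)]}) = inv\<^bsub>H\<^esub> (f a)"
      using a h(2) by (simp add: pres_gen_closed h.hom_inv)
    have "h (pres_rel S R `` {[x] @ w})
        = h (pres_rel S R `` {[x]}) \<otimes>\<^bsub>H\<^esub> h (pres_rel S R `` {w})"
      using a w x presented_group_mult_class[of "[x]" S w R]
        h.hom_mult[of "pres_rel S R `` {[x]}" "pres_rel S R `` {w}"]
      by (simp add: presented_group_class_closed)
    then show ?case using x pos neg Cons.IH[OF w] by simp
  qed
  with X show ?thesis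
    by (elim presented_group_carrier_cases) (simp add: pres_lift_class assms(1))
qed

end


section \<open>Coxeter groups\<close>

text \<open>The relators are the words \<open>(st)\<^sup>k\<close> with \<open>k = M s t\<close>; thus \<open>M s s = 1\<close> makes \<open>s\<close> an
  involution, while \<open>M s t = 0\<close> encodes infinite order.\<close>

definition coxeter_relators :: "'a set \<Rightarrow> ('a \<Rightarrow> 'a \<Rightarrow> nat) \<Rightarrow> 'a word set" where
  "coxeter_relators S M =
     {concat (replicate (M s t) [(True, s), (True, t)]) | s t. s \<in> S \<and> t \<in> S}"

definition coxeter_group :: "'a set \<Rightarrow> ('a \<Rightarrow> 'a \<Rightarrow> nat) \<Rightarrow> 'a word set monoid" where
  "coxeter_group S M = presented_group S (coxeter_relators S M)"

definition coxeter_gen :: "'a set \<Rightarrow> ('a \<Rightarrow> 'a \<Rightarrow> nat) \<Rightarrow> 'a \<Rightarrow> 'a word set" where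
  "coxeter_gen S M = pres_gen S (coxeter_relators S M)"


section \<open>The affine types B and D\<close>

text \<open>\<open>Sig i\<close>, \<open>SigBar i\<close>, \<open>Tee m\<close> are the labels of $\sigma_i$, $\sigma_{\bar i}$, $t_m$.\<close>

datatype label = Sig nat | SigBar nat | Tee nat

definition B_labels :: "nat \<Rightarrow> label set" where
  "B_labels m = Sig ` {1..m - 1} \<union> {SigBar 1, Tee m}"

definition B_matrix :: "nat \<Rightarrow> label \<Rightarrow> label \<Rightarrow> nat" where
  "B_matrix m s t =
     (if s = t then 1
      else if {s, t} = {Sig (m - 1), Tee m} then 4
      else if (\<exists>i \<in> {1..m - 2}. {s, t} = {Sig i, Sig (i + 1)}) \<or> {s, t} = {SigBar 1, Sig 2} then 3
      else 2)"

definition D_labels :: "nat \<Rightarrow> label set" where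
  "D_labels m = Sig ` {1..m - 1} \<union> {SigBar 1, SigBar (m - 1)}"

definition D_matrix :: "nat \<Rightarrow> label \<Rightarrow> label \<Rightarrow> nat" where
  "D_matrix m s t =
     (if s = t then 1
      else if (\<exists>i \<in> {1..m - 2}. {s, t} = {Sig i, Sig (i + 1)}) \<or> {s, t} = {SigBar 1, Sig 2}
        \<or> {s, t} = {Sig (m - 2), SigBar (m - 1)} then 3
      else 2)"

definition W_B :: "nat \<Rightarrow> label word set monoid" where
  "W_B m = coxeter_group (B_labels m) (B_matrix m)"

definition W_D :: "nat \<Rightarrow> label word set monoid" where
  "W_D m = coxeter_group (D_labels m) (D_matrix m)"

definition gen_B :: "nat \<Rightarrow> label \<Rightarrow> label word set" where
  "gen_B m = coxeter_gen (B_labels m) (B_matrix m)"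

definition gen_D :: "nat \<Rightarrow> label \<Rightarrow> label word set" where
  "gen_D m = coxeter_gen (D_labels m) (D_matrix m)"


section \<open>The maps between consecutive ranks\<close>

definition L_images :: "nat \<Rightarrow> label \<Rightarrow> label word set" where
  "L_images n s =
     (if s = Tee n
      then gen_B (Suc n) (Sig n) \<otimes>\<^bsub>W_B (Suc n)\<^esub> gen_B (Suc n) (Tee (Suc n))
             \<otimes>\<^bsub>W_B (Suc n)\<^esub> gen_B (Suc n) (Sig n)
      else gen_B (Suc n) s)"

definition L_map :: "nat \<Rightarrow> label word set \<Rightarrow> label word set" where
  "L_map n = pres_lift (W_B (Suc n)) (L_images n)"

definition G_images :: "nat \<Rightarrow> label \<Rightarrow> label word set" where
  "G_images n s =
     (if s = SigBar (n - 1)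
      then gen_D (Suc n) (Sig n) \<otimes>\<^bsub>W_D (Suc n)\<^esub> gen_D (Suc n) (Sig (n - 1))
             \<otimes>\<^bsub>W_D (Suc n)\<^esub> gen_D (Suc n) (SigBar n)
             \<otimes>\<^bsub>W_D (Suc n)\<^esub> gen_D (Suc n) (Sig (n - 1))
             \<otimes>\<^bsub>W_D (Suc n)\<^esub> gen_D (Suc n) (Sig n)
      else gen_D (Suc n) s)"

definition G_map :: "nat \<Rightarrow> label word set \<Rightarrow> label word set" where
  "G_map n = pres_lift (W_D (Suc n)) (G_images n)"


section \<open>The formulas respect the Coxeter relations\<close>

context group
begin

lemma pow_swap_one:
  assumes "a \<in> carrier G" "b \<in> carrier G" "(a \<otimes> b) [^] (k::nat) = \<one>"
  shows "(b \<otimes> a) [^] k = \<one>"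
proof -
  have "a \<otimes> (b \<otimes> a) [^] k = (a \<otimes> b) [^] k \<otimes> a"
    using assms(1,2) by (induction k) (simp_all flip: m_assoc)
  then show ?thesis using assms by simp
qed

lemma conj_involution_pow:
  assumes "c \<in> carrier G" "x \<in> carrier G" "c \<otimes> c = \<one>" "x [^] (k::nat) = \<one>"
  shows "(c \<otimes> x \<otimes> c) [^] k = \<one>"
proof -
  have "(c \<otimes> x \<otimes> c) [^] j = c \<otimes> x [^] j \<otimes> c" for j :: nat
  proof (induction j)
    case (Suc j)
    have "c \<otimes> (c \<otimes> y) = y" if "y \<in> carrier G" for y
      using assms that by (simp flip: m_assoc)
    with Suc show ?case using assms by (simp add: m_assoc)
  qed (use assms in simp)
  then show ?thesis using assms by simp
qed

lemma involutions_commute: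
  assumes "a \<in> carrier G" "b \<in> carrier G" "a \<otimes> a = \<one>" "b \<otimes> b = \<one>" "(a \<otimes> b) [^] (2::nat) = \<one>"
  shows "a \<otimes> b = b \<otimes> a"
proof -
  have "(a \<otimes> b) \<otimes> (a \<otimes> b) = \<one>" using assms by (simp add: numeral_2_eq_2)
  then have "inv (a \<otimes> b) = a \<otimes> b" using assms by (simp add: inv_equality)
  moreover have "inv a = a" "inv b = b" using assms by (simp_all add: inv_equality)
  ultimately show ?thesis using assms by (simp add: inv_mult_group)
qed

lemma involutions_braid:
  assumes "a \<in> carrier G" "b \<in> carrier G" "a \<otimes> a = \<one>" "b \<otimes> b = \<one>" "(a \<otimes> b) [^] (3::nat) = \<one>"
  shows "a \<otimes> (b \<otimes> a) = b \<otimes> (a \<otimes> b)"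
proof -
  have "(a \<otimes> (b \<otimes> a)) \<otimes> (b \<otimes> (a \<otimes> b)) = \<one>"
    using assms by (simp add: numeral_3_eq_3 m_assoc)
  then have "inv (b \<otimes> (a \<otimes> b)) = a \<otimes> (b \<otimes> a)" using assms by (simp add: inv_equality)
  moreover have "inv a = a" "inv b = b" using assms by (simp_all add: inv_equality)
  ultimately show ?thesis using assms by (simp add: inv_mult_group m_assoc)
qed

lemma involution_cancel:
  "a \<in> carrier G \<Longrightarrow> a \<otimes> a = \<one> \<Longrightarrow> y \<in> carrier G \<Longrightarrow> a \<otimes> (a \<otimes> y) = y"
  by (simp flip: m_assoc)

end

lemma word_eval_power:
  assumes "group H" "a \<in> carrier H" "b \<in> carrier H" "f s = a" "f t = b"
  shows "word_eval H f (concat (replicate k [(True, s), (True, t)])) = (a \<otimes>\<^bsub>H\<^esub> b) [^]\<^bsub>H\<^esub> k"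
proof -
  interpret group H by fact
  have "(a \<otimes>\<^bsub>H\<^esub> b) [^]\<^bsub>H\<^esub> Suc j = a \<otimes>\<^bsub>H\<^esub> (b \<otimes>\<^bsub>H\<^esub> (a \<otimes>\<^bsub>H\<^esub> b) [^]\<^bsub>H\<^esub> j)" for j
    using assms(2,3) nat_pow_Suc2[of "a \<otimes>\<^bsub>H\<^esub> b" j] by (simp add: m_assoc del: nat_pow_Suc)
  then show ?thesis
    using assms(2-) by (induction k) (simp_all del: nat_pow_Suc)
qed

lemma coxeter_relators_eval:
  assumes "group H" "f \<in> S \<rightarrow> carrier H"
    and "\<And>s t. s \<in> S \<Longrightarrow> t \<in> S \<Longrightarrow> (f s \<otimes>\<^bsub>H\<^esub> f t) [^]\<^bsub>H\<^esub> M s t = \<one>\<^bsub>H\<^esub>"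
    and "r \<in> coxeter_relators S M"
  shows "word_eval H f r = \<one>\<^bsub>H\<^esub>"
  proof -
  obtain s t where st: "s \<in> S" "t \<in> S" "r = concat (replicate (M s t) [(True, s), (True, t)])"
    using assms(4) by (auto simp: coxeter_relators_def)
  with assms(2) have "f s \<in> carrier H" "f t \<in> carrier H" by auto
  then show ?thesis
    using word_eval_power[OF assms(1)] assms(3) st by metis
qed

lemma group_coxeter_group: "group (coxeter_group S M)"
  by (simp add: coxeter_group_def group_presented_group)

lemma coxeter_gen_closed: "s \<in> S \<Longrightarrow> coxeter_gen S M s \<in> carrier (coxeter_group S M)"
  by (simp add: coxeter_group_def coxeter_gen_def pres_gen_closed)

lemma coxeter_gen_relation:
  assumes "s \<in> S" "t \<in> S"
  shows "(coxeter_gen S M s \<otimes>\<^bsub>coxeter_group S M\<^esub> coxeter_gen S M t)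
           [^]\<^bsub>coxeter_group S M\<^esub> M s t = \<one>\<^bsub>coxeter_group S M\<^esub>"
proof -
  let ?R = "coxeter_relators S M"
  interpret group "presented_group S ?R" by (rule group_presented_group)
  define u where "u = [(True, s), (True, t)]"
  have u: "u \<in> words S" using assms by (simp add: u_def)
  have comm: "u @ concat (replicate k u) = concat (replicate k u) @ u" for k
    by (induction k) simp_all
  have pow: "concat (replicate k u) \<in> words S \<and>
      pres_rel S ?R `` {u} [^]\<^bsub>presented_group S ?R\<^esub> k = pres_rel S ?R `` {concat (replicate k u)}" for k :: nat
    using u
    by (induction k)
       (simp_all add: presented_group_one presented_group_mult_class comm)
  have "concat (replicate (M s t) u) \<in> ?R"
    using assms by (auto simp: coxeter_relators_def u_def)
  then have "pres_eq S ?R ([] @ concat (replicate (M s t) u) @ []) ([] @ [])"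
    using pow by (intro pres_eq.relator) auto
  then have "pres_rel S ?R `` {concat (replicate (M s t) u)} = pres_rel S ?R `` {[]}"
    using pow by (simp add: pres_class_eq_iff)
  then show ?thesis
    using pow[of "M s t"] assms
    by (simp add: coxeter_group_def coxeter_gen_def pres_gen_def presented_group_mult_class
        presented_group_one u_def)
qed

lemma B_matrix_sym: "B_matrix m s t = B_matrix m t s"
  by (simp add: B_matrix_def insert_commute eq_commute[of s])

lemma D_matrix_sym: "D_matrix m s t = D_matrix m t s"
  by (simp add: D_matrix_def insert_commute eq_commute[of s])

lemma gen_B_relation:
  "s \<in> B_labels m \<Longrightarrow> t \<in> B_labels m \<Longrightarrow>
     (gen_B m s \<otimes>\<^bsub>W_B m\<^esub> gen_B m t) [^]\<^bsub>W_B m\<^esub> B_matrix m s t = \<one>\<^bsub>W_B m\<^esub>"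
  by (simp add: gen_B_def W_B_def coxeter_gen_relation)

lemma gen_D_relation:
  "s \<in> D_labels m \<Longrightarrow> t \<in> D_labels m \<Longrightarrow>
     (gen_D m s \<otimes>\<^bsub>W_D m\<^esub> gen_D m t) [^]\<^bsub>W_D m\<^esub> D_matrix m s t = \<one>\<^bsub>W_D m\<^esub>"
  by (simp add: gen_D_def W_D_def coxeter_gen_relation)

lemma gen_B_closed: "s \<in> B_labels m \<Longrightarrow> gen_B m s \<in> carrier (W_B m)"
  by (simp add: gen_B_def W_B_def coxeter_gen_closed)

lemma gen_D_closed: "s \<in> D_labels m \<Longrightarrow> gen_D m s \<in> carrier (W_D m)"
  by (simp add: gen_D_def W_D_def coxeter_gen_closed)

lemma group_W_B: "group (W_B m)" and group_W_D: "group (W_D m)"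
  by (simp_all add: W_B_def W_D_def group_coxeter_group)

lemma L_images_closed:
  assumes "n \<ge> 3" "s \<in> B_labels n"
  shows "L_images n s \<in> carrier (W_B (Suc n))"
proof -
  interpret group "W_B (Suc n)" by (rule group_W_B)
  show ?thesis using assms
    by (auto simp: L_images_def B_labels_def intro!: m_closed gen_B_closed)
qed

lemma L_images_relation:
  assumes n: "n \<ge> 3" and s: "s \<in> B_labels n" and t: "t \<in> B_labels n"
  shows "(L_images n s \<otimes>\<^bsub>W_B (Suc n)\<^esub> L_images n t) [^]\<^bsub>W_B (Suc n)\<^esub> B_matrix n s t
           = \<one>\<^bsub>W_B (Suc n)\<^esub>"
proof -
  let ?G = "W_B (Suc n)"
  interpret group ?G by (rule group_W_B)
  let ?g = "gen_B (Suc n)"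
  let ?L = "B_labels (Suc n)"
  let ?M = "B_matrix (Suc n)"
  have rel: "(?g a \<otimes>\<^bsub>?G\<^esub> ?g b) [^]\<^bsub>?G\<^esub> ?M a b = \<one>\<^bsub>?G\<^esub>" if "a \<in> ?L" "b \<in> ?L" for a b
    using that by (rule gen_B_relation)
  have cl: "?g a \<in> carrier ?G" if "a \<in> ?L" for a using that by (rule gen_B_closed)
  have inv2: "?g a \<otimes>\<^bsub>?G\<^esub> ?g a = \<one>\<^bsub>?G\<^esub>" if "a \<in> ?L" for a
    using rel[of a a] that cl by (simp add: B_matrix_def)
  have comm: "?g a \<otimes>\<^bsub>?G\<^esub> ?g b = ?g b \<otimes>\<^bsub>?G\<^esub> ?g a" if "a \<in> ?L" "b \<in> ?L" "?M a b = 2" for a b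
    using that rel[of a b] by (intro involutions_commute) (auto simp: cl inv2)
  define c T where "c = ?g (Sig n)" and "T = ?g (Tee (Suc n))"
  have cL: "Sig n \<in> ?L" "Tee (Suc n) \<in> ?L" using n by (auto simp: B_labels_def)
  have c: "c \<in> carrier ?G" "T \<in> carrier ?G" "c \<otimes>\<^bsub>?G\<^esub> c = \<one>\<^bsub>?G\<^esub>" "T \<otimes>\<^bsub>?G\<^esub> T = \<one>\<^bsub>?G\<^esub>"
    using cL by (auto simp: c_def T_def cl inv2)
  have LT: "L_images n (Tee n) = c \<otimes>\<^bsub>?G\<^esub> T \<otimes>\<^bsub>?G\<^esub> c" by (simp add: L_images_def c_def T_def)
  have Lx: "L_images n x = ?g x" if "x \<noteq> Tee n" for x using that by (simp add: L_images_def)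
  have xL: "x \<in> ?L" if "x \<in> B_labels n" "x \<noteq> Tee n" for x
    using that by (auto simp: B_labels_def)
  have main: "(L_images n (Tee n) \<otimes>\<^bsub>?G\<^esub> L_images n x) [^]\<^bsub>?G\<^esub> B_matrix n (Tee n) x = \<one>\<^bsub>?G\<^esub>"
    if x: "x \<in> B_labels n" "x \<noteq> Tee n" for x
  proof (cases "x = Sig (n - 1)")
    case True
    define y where "y = ?g x"
    have y: "y \<in> carrier ?G" "y \<otimes>\<^bsub>?G\<^esub> y = \<one>\<^bsub>?G\<^esub>" using xL[OF x] by (auto simp: y_def cl inv2)
    have "?M (Sig n) x = 3"
      using n True by (auto simp: B_matrix_def doubleton_eq_iff intro!: bexI[of _ "n - 1"])
    then have br: "c \<otimes>\<^bsub>?G\<^esub> (y \<otimes>\<^bsub>?G\<^esub> c) = y \<otimes>\<^bsub>?G\<^esub> (c \<otimes>\<^bsub>?G\<^esub> y)"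
      using rel[of "Sig n" x] cL xL[OF x] c y
      by (intro involutions_braid) (auto simp: c_def y_def)
    have "?M (Tee (Suc n)) x = 2" using n True by (auto simp: B_matrix_def doubleton_eq_iff)
    then have Ty: "T \<otimes>\<^bsub>?G\<^esub> y = y \<otimes>\<^bsub>?G\<^esub> T"
      using comm cL xL[OF x] by (simp add: T_def y_def)
    have "?M (Tee (Suc n)) (Sig n) = 4" by (auto simp: B_matrix_def doubleton_eq_iff)
    then have T4: "(T \<otimes>\<^bsub>?G\<^esub> c) [^]\<^bsub>?G\<^esub> (4::nat) = \<one>\<^bsub>?G\<^esub>"
      using rel[of "Tee (Suc n)" "Sig n"] cL by (simp add: T_def c_def)
    have "c \<otimes>\<^bsub>?G\<^esub> T \<otimes>\<^bsub>?G\<^esub> c \<otimes>\<^bsub>?G\<^esub> y = c \<otimes>\<^bsub>?G\<^esub> (T \<otimes>\<^bsub>?G\<^esub> (c \<otimes>\<^bsub>?G\<^esub> (y \<otimes>\<^bsub>?G\<^esub> c))) \<otimes>\<^bsub>?G\<^esub> c"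
      using c y by (simp add: m_assoc)
    also have "T \<otimes>\<^bsub>?G\<^esub> (c \<otimes>\<^bsub>?G\<^esub> (y \<otimes>\<^bsub>?G\<^esub> c)) = (T \<otimes>\<^bsub>?G\<^esub> y) \<otimes>\<^bsub>?G\<^esub> (c \<otimes>\<^bsub>?G\<^esub> y)"
      using c y by (simp add: br m_assoc)
    also have "\<dots> = y \<otimes>\<^bsub>?G\<^esub> (T \<otimes>\<^bsub>?G\<^esub> c) \<otimes>\<^bsub>?G\<^esub> y"
      using c y by (simp add: Ty m_assoc)
    finally have "(c \<otimes>\<^bsub>?G\<^esub> T \<otimes>\<^bsub>?G\<^esub> c \<otimes>\<^bsub>?G\<^esub> y) [^]\<^bsub>?G\<^esub> (4::nat) = \<one>\<^bsub>?G\<^esub>"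
      using c y T4 by (simp add: conj_involution_pow)
    moreover have "B_matrix n (Tee n) x = 4"
      using True by (auto simp: B_matrix_def doubleton_eq_iff)
    ultimately show ?thesis using x by (simp add: LT Lx y_def)
  next
    case False
    define y where "y = ?g x"
    have y: "y \<in> carrier ?G" using xL[OF x] by (auto simp: y_def cl)
    have "?M x (Sig n) = 2" "?M (Tee (Suc n)) x = 2"
      using n x False by (auto simp: B_matrix_def B_labels_def doubleton_eq_iff)
    then have yc: "y \<otimes>\<^bsub>?G\<^esub> c = c \<otimes>\<^bsub>?G\<^esub> y" and Ty: "(T \<otimes>\<^bsub>?G\<^esub> y) [^]\<^bsub>?G\<^esub> (2::nat) = \<one>\<^bsub>?G\<^esub>"
      using comm[of x "Sig n"] rel[of "Tee (Suc n)" x] cL xL[OF x]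
      by (simp_all add: T_def y_def c_def)
    have "c \<otimes>\<^bsub>?G\<^esub> T \<otimes>\<^bsub>?G\<^esub> c \<otimes>\<^bsub>?G\<^esub> y = c \<otimes>\<^bsub>?G\<^esub> (T \<otimes>\<^bsub>?G\<^esub> y) \<otimes>\<^bsub>?G\<^esub> c"
      using c y by (simp add: m_assoc yc)
    then have "(c \<otimes>\<^bsub>?G\<^esub> T \<otimes>\<^bsub>?G\<^esub> c \<otimes>\<^bsub>?G\<^esub> y) [^]\<^bsub>?G\<^esub> (2::nat) = \<one>\<^bsub>?G\<^esub>"
      using c y Ty by (simp add: conj_involution_pow)
    moreover have "B_matrix n (Tee n) x = 2"
      using x False by (auto simp: B_matrix_def B_labels_def doubleton_eq_iff)
    ultimately show ?thesis using x by (simp add: LT Lx y_def)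
  qed
  consider "s = Tee n" "t = Tee n" | "s = Tee n" "t \<noteq> Tee n" | "s \<noteq> Tee n" "t = Tee n"
    | "s \<noteq> Tee n" "t \<noteq> Tee n" by blast
  then show ?thesis
  proof cases
    case 1
    have "c \<otimes>\<^bsub>?G\<^esub> T \<otimes>\<^bsub>?G\<^esub> c \<otimes>\<^bsub>?G\<^esub> (c \<otimes>\<^bsub>?G\<^esub> T \<otimes>\<^bsub>?G\<^esub> c) = \<one>\<^bsub>?G\<^esub>"
      using c by (simp add: m_assoc involution_cancel)
    with 1 c show ?thesis by (simp add: LT B_matrix_def)
  next
    case 2
    with main t show ?thesis by simp
  next
    case 3
    have "(L_images n t \<otimes>\<^bsub>?G\<^esub> L_images n s) [^]\<^bsub>?G\<^esub> B_matrix n s t = \<one>\<^bsub>?G\<^esub>"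
      using 3 main[OF s] by (simp add: B_matrix_sym)
    with L_images_closed[OF n t] L_images_closed[OF n s] show ?thesis
      by (rule pow_swap_one)
  next
    case 4
    have Sig_lt: "i + 1 < n" if "{s, t} = {Sig i, Sig (i + 1)}" for i
    proof -
      have "Sig (i + 1) \<in> {s, t}" unfolding that by simp
      then have "Sig (i + 1) \<in> B_labels n" using s t by auto
      then show ?thesis by (auto simp: B_labels_def)
    qed
    have chain: "(\<exists>i \<in> {1..Suc n - 2}. {s, t} = {Sig i, Sig (i + 1)}) \<longleftrightarrow>
        (\<exists>i \<in> {1..n - 2}. {s, t} = {Sig i, Sig (i + 1)})"
      using Sig_lt by fastforce
    have "{s, t} \<noteq> {Sig (Suc n - 1), Tee (Suc n)}"
    proof
      assume eq: "{s, t} = {Sig (Suc n - 1), Tee (Suc n)}"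
      have "Tee (Suc n) \<in> {s, t}" unfolding eq by simp
      then have "Tee (Suc n) \<in> B_labels n" using s t by auto
      then show False by (auto simp: B_labels_def)
    qed
    moreover have "{s, t} \<noteq> {Sig (n - 1), Tee n}"
      using 4 by (auto simp: doubleton_eq_iff)
    ultimately have "?M s t = B_matrix n s t"
      unfolding B_matrix_def chain by (simp only: if_False simp_thms)
    with 4 rel[of s t] s t xL show ?thesis by (simp add: Lx)
  qed
qed

lemma G_images_closed:
  assumes "n \<ge> 4" "s \<in> D_labels n"
  shows "G_images n s \<in> carrier (W_D (Suc n))"
proof -
  interpret group "W_D (Suc n)" by (rule group_W_D)
  show ?thesis using assms
    by (auto simp: G_images_def D_labels_def intro!: m_closed gen_D_closed)
qed

lemma G_images_relation:
  assumes n: "n \<ge> 4" and s: "s \<in> D_labels n" and t: "t \<in> D_labels n"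
  shows "(G_images n s \<otimes>\<^bsub>W_D (Suc n)\<^esub> G_images n t) [^]\<^bsub>W_D (Suc n)\<^esub> D_matrix n s t
           = \<one>\<^bsub>W_D (Suc n)\<^esub>"
proof -
  let ?G = "W_D (Suc n)"
  interpret group ?G by (rule group_W_D)
  let ?g = "gen_D (Suc n)"
  let ?L = "D_labels (Suc n)"
  let ?M = "D_matrix (Suc n)"
  let ?t = "SigBar (n - 1)"
  have rel: "(?g a \<otimes>\<^bsub>?G\<^esub> ?g b) [^]\<^bsub>?G\<^esub> ?M a b = \<one>\<^bsub>?G\<^esub>" if "a \<in> ?L" "b \<in> ?L" for a b
    using that by (rule gen_D_relation)
  have cl: "?g a \<in> carrier ?G" if "a \<in> ?L" for a using that by (rule gen_D_closed)
  have inv2: "?g a \<otimes>\<^bsub>?G\<^esub> ?g a = \<one>\<^bsub>?G\<^esub>" if "a \<in> ?L" for a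
    using rel[of a a] that cl by (simp add: D_matrix_def)
  have comm: "?g a \<otimes>\<^bsub>?G\<^esub> ?g b = ?g b \<otimes>\<^bsub>?G\<^esub> ?g a" if "a \<in> ?L" "b \<in> ?L" "?M a b = 2" for a b
    using that rel[of a b] by (intro involutions_commute) (auto simp: cl inv2)
  have braid: "?g a \<otimes>\<^bsub>?G\<^esub> (?g b \<otimes>\<^bsub>?G\<^esub> ?g a) = ?g b \<otimes>\<^bsub>?G\<^esub> (?g a \<otimes>\<^bsub>?G\<^esub> ?g b)"
    if "a \<in> ?L" "b \<in> ?L" "?M a b = 3" for a b
    using that rel[of a b] by (intro involutions_braid) (auto simp: cl inv2)
  define c y b where "c = ?g (Sig n)" and "y = ?g (Sig (n - 1))" and "b = ?g (SigBar n)"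
  have cL: "Sig n \<in> ?L" "Sig (n - 1) \<in> ?L" "SigBar n \<in> ?L" using n by (auto simp: D_labels_def)
  have c: "c \<in> carrier ?G" "y \<in> carrier ?G" "b \<in> carrier ?G"
    "c \<otimes>\<^bsub>?G\<^esub> c = \<one>\<^bsub>?G\<^esub>" "y \<otimes>\<^bsub>?G\<^esub> y = \<one>\<^bsub>?G\<^esub>" "b \<otimes>\<^bsub>?G\<^esub> b = \<one>\<^bsub>?G\<^esub>"
    using cL by (auto simp: c_def y_def b_def cl inv2)
  have Mcy: "?M (Sig n) (Sig (n - 1)) = 3" "?M (SigBar n) (Sig (n - 1)) = 3" "?M (SigBar n) (Sig n) = 2"
    using n by (auto simp: D_matrix_def doubleton_eq_iff intro!: bexI[of _ "n - 1"])
  have cyc: "c \<otimes>\<^bsub>?G\<^esub> (y \<otimes>\<^bsub>?G\<^esub> c) = y \<otimes>\<^bsub>?G\<^esub> (c \<otimes>\<^bsub>?G\<^esub> y)"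
    using braid[OF cL(1,2) Mcy(1)] by (simp add: c_def y_def)
  have by3: "(b \<otimes>\<^bsub>?G\<^esub> y) [^]\<^bsub>?G\<^esub> (3::nat) = \<one>\<^bsub>?G\<^esub>" and bc2: "(b \<otimes>\<^bsub>?G\<^esub> c) [^]\<^bsub>?G\<^esub> (2::nat) = \<one>\<^bsub>?G\<^esub>"
    using rel[OF cL(3,2)] rel[OF cL(3,1)] Mcy by (simp_all add: b_def y_def c_def)
  have LT: "G_images n ?t = c \<otimes>\<^bsub>?G\<^esub> y \<otimes>\<^bsub>?G\<^esub> b \<otimes>\<^bsub>?G\<^esub> y \<otimes>\<^bsub>?G\<^esub> c"
    by (simp add: G_images_def c_def y_def b_def)
  have Lx: "G_images n x = ?g x" if "x \<noteq> ?t" for x using that by (simp add: G_images_def)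
  have xL: "x \<in> ?L" if "x \<in> D_labels n" "x \<noteq> ?t" for x
    using that by (auto simp: D_labels_def)
  have main: "(G_images n ?t \<otimes>\<^bsub>?G\<^esub> G_images n x) [^]\<^bsub>?G\<^esub> D_matrix n ?t x = \<one>\<^bsub>?G\<^esub>"
    if x: "x \<in> D_labels n" "x \<noteq> ?t" for x
  proof -
    define z where "z = ?g x"
    have z: "z \<in> carrier ?G" "z \<otimes>\<^bsub>?G\<^esub> z = \<one>\<^bsub>?G\<^esub>" using xL[OF x] by (auto simp: z_def cl inv2)
    let ?w = "c \<otimes>\<^bsub>?G\<^esub> y \<otimes>\<^bsub>?G\<^esub> b \<otimes>\<^bsub>?G\<^esub> y \<otimes>\<^bsub>?G\<^esub> c \<otimes>\<^bsub>?G\<^esub> z"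
    consider "x = Sig (n - 1)" | "x = Sig (n - 2)" | "x \<noteq> Sig (n - 1)" "x \<noteq> Sig (n - 2)" by blast
    then have "?w [^]\<^bsub>?G\<^esub> D_matrix n ?t x = \<one>\<^bsub>?G\<^esub>"
    proof cases
      case 1
      then have zy: "z = y" by (simp add: z_def y_def)
      have "?w = c \<otimes>\<^bsub>?G\<^esub> (y \<otimes>\<^bsub>?G\<^esub> (b \<otimes>\<^bsub>?G\<^esub> (y \<otimes>\<^bsub>?G\<^esub> (c \<otimes>\<^bsub>?G\<^esub> (y \<otimes>\<^bsub>?G\<^esub> c))))) \<otimes>\<^bsub>?G\<^esub> c"
        using c by (simp add: m_assoc zy)
      also have "c \<otimes>\<^bsub>?G\<^esub> (y \<otimes>\<^bsub>?G\<^esub> c) = y \<otimes>\<^bsub>?G\<^esub> (c \<otimes>\<^bsub>?G\<^esub> y)" by (rule cyc)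
      also have "y \<otimes>\<^bsub>?G\<^esub> (y \<otimes>\<^bsub>?G\<^esub> (c \<otimes>\<^bsub>?G\<^esub> y)) = c \<otimes>\<^bsub>?G\<^esub> y" using c by (simp add: involution_cancel)
      also have "y \<otimes>\<^bsub>?G\<^esub> (b \<otimes>\<^bsub>?G\<^esub> (c \<otimes>\<^bsub>?G\<^esub> y)) = y \<otimes>\<^bsub>?G\<^esub> (b \<otimes>\<^bsub>?G\<^esub> c) \<otimes>\<^bsub>?G\<^esub> y" using c by (simp add: m_assoc)
      finally have "?w [^]\<^bsub>?G\<^esub> (2::nat) = \<one>\<^bsub>?G\<^esub>"
        using c bc2 by (simp add: conj_involution_pow)
      moreover have "D_matrix n ?t x = 2" using 1 n by (auto simp: D_matrix_def doubleton_eq_iff)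
      ultimately show ?thesis by simp
    next
      case 2
      have "\<exists>i \<in> {1..Suc n - 2}. {Sig (n - 1), Sig (n - 2)} = {Sig i, Sig (i + 1)}"
        using n by (intro bexI[of _ "n - 2"]) (auto simp: doubleton_eq_iff)
      then have "?M (Sig (n - 1)) x = 3"
        using 2 n by (simp add: D_matrix_def)
      moreover have "?M x (Sig n) = 2" "?M (SigBar n) x = 2"
        using 2 n by (auto simp: D_matrix_def doubleton_eq_iff)
      ultimately have M: "?M x (Sig n) = 2" "?M (SigBar n) x = 2" "?M (Sig (n - 1)) x = 3"
        by blast+
      have zc: "z \<otimes>\<^bsub>?G\<^esub> c = c \<otimes>\<^bsub>?G\<^esub> z" and bz: "b \<otimes>\<^bsub>?G\<^esub> z = z \<otimes>\<^bsub>?G\<^esub> b"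
        and yzy: "y \<otimes>\<^bsub>?G\<^esub> (z \<otimes>\<^bsub>?G\<^esub> y) = z \<otimes>\<^bsub>?G\<^esub> (y \<otimes>\<^bsub>?G\<^esub> z)"
        using comm[of x "Sig n"] comm[of "SigBar n" x] braid[of "Sig (n - 1)" x] cL xL[OF x] M
        by (simp_all add: z_def c_def b_def y_def)
      have "?w = c \<otimes>\<^bsub>?G\<^esub> (y \<otimes>\<^bsub>?G\<^esub> (b \<otimes>\<^bsub>?G\<^esub> (y \<otimes>\<^bsub>?G\<^esub> (z \<otimes>\<^bsub>?G\<^esub> y))) \<otimes>\<^bsub>?G\<^esub> y) \<otimes>\<^bsub>?G\<^esub> c"
        using c z by (simp add: m_assoc zc involution_cancel)
      also have "b \<otimes>\<^bsub>?G\<^esub> (y \<otimes>\<^bsub>?G\<^esub> (z \<otimes>\<^bsub>?G\<^esub> y)) = (b \<otimes>\<^bsub>?G\<^esub> z) \<otimes>\<^bsub>?G\<^esub> (y \<otimes>\<^bsub>?G\<^esub> z)"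
        using c z by (simp add: yzy m_assoc)
      also have "\<dots> = z \<otimes>\<^bsub>?G\<^esub> (b \<otimes>\<^bsub>?G\<^esub> y) \<otimes>\<^bsub>?G\<^esub> z" using c z by (simp add: bz m_assoc)
      finally have "?w [^]\<^bsub>?G\<^esub> (3::nat) = \<one>\<^bsub>?G\<^esub>"
        using c z by3 by (simp add: conj_involution_pow)
      moreover have "D_matrix n ?t x = 3" using 2 n by (auto simp: D_matrix_def doubleton_eq_iff)
      ultimately show ?thesis by simp
    next
      case 3
      have M: "?M x (Sig n) = 2" "?M (SigBar n) x = 2" "?M x (Sig (n - 1)) = 2"
        using 3 n x by (auto simp: D_matrix_def D_labels_def doubleton_eq_iff)
      have zc: "z \<otimes>\<^bsub>?G\<^esub> c = c \<otimes>\<^bsub>?G\<^esub> z" and zy: "z \<otimes>\<^bsub>?G\<^esub> y = y \<otimes>\<^bsub>?G\<^esub> z"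
        and bz: "(b \<otimes>\<^bsub>?G\<^esub> z) [^]\<^bsub>?G\<^esub> (2::nat) = \<one>\<^bsub>?G\<^esub>"
        using comm[of x "Sig n"] comm[of x "Sig (n - 1)"] rel[of "SigBar n" x] cL xL[OF x] M
        by (simp_all add: z_def c_def b_def y_def)
      have "?w = c \<otimes>\<^bsub>?G\<^esub> (y \<otimes>\<^bsub>?G\<^esub> (b \<otimes>\<^bsub>?G\<^esub> (y \<otimes>\<^bsub>?G\<^esub> z))) \<otimes>\<^bsub>?G\<^esub> c"
        using c z by (simp add: m_assoc zc)
      also have "y \<otimes>\<^bsub>?G\<^esub> z = z \<otimes>\<^bsub>?G\<^esub> y" by (rule zy[symmetric])
      also have "y \<otimes>\<^bsub>?G\<^esub> (b \<otimes>\<^bsub>?G\<^esub> (z \<otimes>\<^bsub>?G\<^esub> y)) = y \<otimes>\<^bsub>?G\<^esub> (b \<otimes>\<^bsub>?G\<^esub> z) \<otimes>\<^bsub>?G\<^esub> y" using c z by (simp add: m_assoc)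
      finally have "?w [^]\<^bsub>?G\<^esub> (2::nat) = \<one>\<^bsub>?G\<^esub>"
        using c z bz by (simp add: conj_involution_pow)
      moreover have "D_matrix n ?t x = 2"
        using 3 n x by (auto simp: D_matrix_def D_labels_def doubleton_eq_iff)
      ultimately show ?thesis by simp
    qed
    then show ?thesis unfolding LT Lx[OF x(2)] z_def .
  qed
  consider "s = ?t" "t = ?t" | "s = ?t" "t \<noteq> ?t" | "s \<noteq> ?t" "t = ?t"
    | "s \<noteq> ?t" "t \<noteq> ?t" by blast
  then show ?thesis
  proof cases
    case 1
    have "c \<otimes>\<^bsub>?G\<^esub> y \<otimes>\<^bsub>?G\<^esub> b \<otimes>\<^bsub>?G\<^esub> y \<otimes>\<^bsub>?G\<^esub> c \<otimes>\<^bsub>?G\<^esub> (c \<otimes>\<^bsub>?G\<^esub> y \<otimes>\<^bsub>?G\<^esub> b \<otimes>\<^bsub>?G\<^esub> y \<otimes>\<^bsub>?G\<^esub> c) = \<one>\<^bsub>?G\<^esub>"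
      using c by (simp add: m_assoc involution_cancel)
    with 1 c show ?thesis by (simp add: LT[unfolded One_nat_def] D_matrix_def)
  next
    case 2
    with main t show ?thesis by simp
  next
    case 3
    have "(G_images n t \<otimes>\<^bsub>?G\<^esub> G_images n s) [^]\<^bsub>?G\<^esub> D_matrix n s t = \<one>\<^bsub>?G\<^esub>"
      using 3 main[OF s] by (simp add: D_matrix_sym)
    with G_images_closed[OF n t] G_images_closed[OF n s] show ?thesis
      by (rule pow_swap_one)
  next
    case 4
    have Sig_lt: "i + 1 < n" if "{s, t} = {Sig i, Sig (i + 1)}" for i
    proof -
      have "Sig (i + 1) \<in> {s, t}" unfolding that by simp
      then have "Sig (i + 1) \<in> D_labels n" using s t by auto
      then show ?thesis by (auto simp: D_labels_def)
    qed
    have chain: "(\<exists>i \<in> {1..Suc n - 2}. {s, t} = {Sig i, Sig (i + 1)}) \<longleftrightarrow>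
        (\<exists>i \<in> {1..n - 2}. {s, t} = {Sig i, Sig (i + 1)})"
      using Sig_lt by fastforce
    have "{s, t} \<noteq> {Sig (Suc n - 2), SigBar (Suc n - 1)}"
    proof
      assume eq: "{s, t} = {Sig (Suc n - 2), SigBar (Suc n - 1)}"
      have "SigBar (Suc n - 1) \<in> {s, t}" unfolding eq by simp
      then have "SigBar (Suc n - 1) \<in> D_labels n" using s t by auto
      then show False using n by (auto simp: D_labels_def)
    qed
    moreover have "{s, t} \<noteq> {Sig (n - 2), SigBar (n - 1)}"
      using 4 by (auto simp: doubleton_eq_iff)
    ultimately have "?M s t = D_matrix n s t"
      unfolding D_matrix_def chain by (simp only: if_False simp_thms)
    with 4 rel[of s t] s t xL show ?thesis by (simp add: Lx)
  qed
qed

theorem L_map_hom: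
  assumes "n \<ge> 3" shows "L_map n \<in> hom (W_B n) (W_B (Suc n))"
  unfolding L_map_def W_B_def[of n] coxeter_group_def
  using L_images_closed[OF assms] L_images_relation[OF assms]
  by (intro pres_lift_hom coxeter_relators_eval[of _ _ "B_labels n" "B_matrix n"] group_W_B) auto

theorem L_map_gen:
  assumes "n \<ge> 3" "s \<in> B_labels n" shows "L_map n (gen_B n s) = L_images n s"
  unfolding L_map_def gen_B_def coxeter_gen_def
  using L_images_closed[OF assms(1)] L_images_relation[OF assms(1)] assms(2)
  by (intro pres_lift_gen coxeter_relators_eval[of _ _ "B_labels n" "B_matrix n"] group_W_B) auto

theorem G_map_hom:
  assumes "n \<ge> 4" shows "G_map n \<in> hom (W_D n) (W_D (Suc n))"
  unfolding G_map_def W_D_def[of n] coxeter_group_def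
  using G_images_closed[OF assms] G_images_relation[OF assms]
  by (intro pres_lift_hom coxeter_relators_eval[of _ _ "D_labels n" "D_matrix n"] group_W_D) auto

theorem G_map_gen:
  assumes "n \<ge> 4" "s \<in> D_labels n" shows "G_map n (gen_D n s) = G_images n s"
  unfolding G_map_def gen_D_def coxeter_gen_def
  using G_images_closed[OF assms(1)] G_images_relation[OF assms(1)] assms(2)
  by (intro pres_lift_gen coxeter_relators_eval[of _ _ "D_labels n" "D_matrix n"] group_W_D) auto

end

theory Submission
  imports Defs "HOL-Algebra.Bij" "HOL-Algebra.Coset" Complex_Main
begin

text \<open>Both maps are compatible with the geometric action of the affine Weyl groups on real vectors,
  where the generators act by the reflections in the walls of the fundamental alcove: \<open>Sig i\<close> is
  the wall \<open>x\<^sub>i = x\<^bsub>i+1\<^esub>\<close>, \<open>SigBar 1\<close> the wall \<open>x\<^sub>1 + x\<^sub>2 = 1\<close>, \<open>SigBar k\<close> with \<open>k \<noteq> 1\<close> the wall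
  \<open>x\<^sub>k + x\<^bsub>k+1\<^esub> = 0\<close>, and \<open>Tee m\<close> the wall \<open>x\<^sub>m = 0\<close>. Conjugating the last wall of rank \<open>n + 1\<close> as
  the formulas prescribe gives the last wall of rank \<open>n\<close> (\<open>reflection_Tee_conj\<close>,
  \<open>reflection_SigBar_conj\<close>). So the representation of rank \<open>n + 1\<close>, composed with the map, is the
  representation of rank \<open>n\<close> on the same space, and injectivity of the map follows from faithfulness
  of the latter (\<open>hom_inj_of_rep_factor\<close>, \<open>rep_inj\<close>).

  Faithfulness is Tits's theorem, proved here in the form that the group given by the Coxeter
  presentation has trivial stabilizer at a point \<open>p\<close> inside the alcove. The core is
  \<open>Pos_of_ascent\<close>: if \<open>s w\<close> is not shorter than \<open>w\<close>, then \<open>w p\<close> lies on the positive side of the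
  wall of \<open>s\<close>. The induction on the length of \<open>w\<close> splits off from \<open>w\<close> a maximal alternating prefix in
  \<open>s\<close> and another generator \<open>t\<close>; the braid relation bounds the length of that prefix, and what
  remains is a computation in the dihedral group of \<open>s\<close> and \<open>t\<close> (\<open>wall_alternating_pos\<close>). A
  nontrivial \<open>w\<close> has a descent \<open>s\<close>, and then \<open>w p\<close> lies on the negative side of the wall of \<open>s\<close>,
  so that \<open>w p \<noteq> p\<close>.\<close>

section \<open>Alternating words\<close>

text \<open>The alternating list \<open>[a, b, a, \<dots>]\<close> of length \<open>k\<close>.\<close>

fun alternating :: "'a \<Rightarrow> 'a \<Rightarrow> nat \<Rightarrow> 'a list" where
  "alternating a b 0 = []"
| "alternating a b (Suc k) = a # alternating b a k"

lemma length_alternating [simp]: "length (alternating a b k) = k"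
  by (induction k arbitrary: a b) auto

lemma set_alternating: "set (alternating a b k) \<subseteq> {a, b}"
  by (induction k arbitrary: a b) fastforce+

lemma alternating_add:
  "alternating a b (i + j) =
     alternating a b i @ (if even i then alternating a b j else alternating b a j)"
  by (induction i arbitrary: a b) auto

lemma alternating_Suc_snoc:
  "alternating a b (Suc k) = alternating a b k @ [if even k then a else b]"
  using alternating_add[of a b k 1] by auto

lemma rev_alternating:
  "rev (alternating a b k) = (if even k then alternating b a k else alternating a b k)"
proof (induction k arbitrary: a b)
  case (Suc k)
  then have "rev (alternating a b (Suc k)) = (if even k then alternating a b k else alternating b a k) @ [a]"
    by simp
  then show ?case by (simp add: alternating_Suc_snoc del: alternating.simps(2))
qed simp

lemma alternating_double: "alternating a b (2 * k) = alternating a b k @ rev (alternating b a k)"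
  using alternating_add[of a b k k] by (simp add: rev_alternating mult_2)


section \<open>Groups generated by involutions\<close>

text \<open>The elements \<open>g s\<close> with \<open>s \<in> S\<close> square to one and generate the group as a monoid.\<close>

locale involution_generated = group G for G (structure) +
  fixes S :: "'s set" and g :: "'s \<Rightarrow> 'a"
  assumes gen_closed [simp]: "s \<in> S \<Longrightarrow> g s \<in> carrier G"
    and gen_square [simp]: "s \<in> S \<Longrightarrow> g s \<otimes> g s = \<one>"
    and generated: "w \<in> carrier G \<Longrightarrow> \<exists>us. set us \<subseteq> S \<and> w = foldr (\<lambda>s. (\<otimes>) (g s)) us \<one>"
begin

text \<open>The value of a positive word.\<close>

definition eval :: "'s list \<Rightarrow> 'a" where
  "eval us = foldr (\<lambda>s. (\<otimes>) (g s)) us \<one>"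

text \<open>The word length of \<open>w\<close>; it is only used for \<open>w \<in> carrier G\<close>.\<close>

definition len :: "'a \<Rightarrow> nat" where
  "len w = (LEAST k. \<exists>us. set us \<subseteq> S \<and> length us = k \<and> w = eval us)"

lemma eval_Nil [simp]: "eval [] = \<one>"
  and eval_Cons [simp]: "eval (s # us) = g s \<otimes> eval us"
  by (simp_all add: eval_def)

lemma eval_closed [simp]: "set us \<subseteq> S \<Longrightarrow> eval us \<in> carrier G"
  by (induction us) auto

lemma eval_append: "set us \<subseteq> S \<Longrightarrow> set vs \<subseteq> S \<Longrightarrow> eval (us @ vs) = eval us \<otimes> eval vs"
  by (induction us) (auto simp: m_assoc)

lemma gen_cancel [simp]: "s \<in> S \<Longrightarrow> w \<in> carrier G \<Longrightarrow> g s \<otimes> (g s \<otimes> w) = w"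
  by (simp add: involution_cancel)

lemma eval_rev: "set us \<subseteq> S \<Longrightarrow> eval us \<otimes> eval (rev us) = \<one>"
proof (induction us)
  case (Cons s us)
  then have "eval us \<otimes> (eval (rev us) \<otimes> g s) = g s"
    by (simp flip: m_assoc)
  with Cons.prems show ?case by (simp add: eval_append m_assoc)
qed simp

lemma len_witness:
  assumes "w \<in> carrier G"
  obtains us where "set us \<subseteq> S" "length us = len w" "w = eval us"
proof -
  have "\<exists>k. \<exists>us. set us \<subseteq> S \<and> length us = k \<and> w = eval us"
    using generated[OF assms] by (auto simp: eval_def)
  from LeastI_ex[OF this] show ?thesis using that by (auto simp: len_def)
qed

lemma len_eval_le: "set us \<subseteq> S \<Longrightarrow> len (eval us) \<le> length us"
  unfolding len_def by (rule Least_le) auto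

lemma len_mult_eval_le:
  assumes "set us \<subseteq> S" "w \<in> carrier G"
  shows "len (eval us \<otimes> w) \<le> length us + len w"
proof -
  obtain vs where "set vs \<subseteq> S" "length vs = len w" "w = eval vs"
    using assms(2) by (rule len_witness)
  with len_eval_le[of "us @ vs"] assms show ?thesis by (simp add: eval_append)
qed

lemma len_gen_le: "s \<in> S \<Longrightarrow> w \<in> carrier G \<Longrightarrow> len w \<le> Suc (len (g s \<otimes> w))"
  using len_mult_eval_le[of "[s]" "g s \<otimes> w"] by simp

lemma len_pos_descent:
  assumes "w \<in> carrier G" "len w > 0"
  obtains s where "s \<in> S" "Suc (len (g s \<otimes> w)) = len w"
proof -
  obtain us where us: "set us \<subseteq> S" "length us = len w" "w = eval us"
    using assms(1) by (rule len_witness)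
  then obtain s vs where vs: "us = s # vs" using assms(2) by (cases us) auto
  with us have s: "s \<in> S" and "g s \<otimes> w = eval vs" by auto
  moreover have "set vs \<subseteq> S" using us vs by simp
  ultimately have "len (g s \<otimes> w) \<le> length vs" using len_eval_le[of vs] by simp
  then have "Suc (len (g s \<otimes> w)) = len w"
    using len_gen_le[OF s assms(1)] us vs by simp
  with s that show ?thesis by blast
qed

lemma len_eq_0: "w \<in> carrier G \<Longrightarrow> len w = 0 \<Longrightarrow> w = \<one>"
  by (metis len_witness length_0_conv eval_Nil)

lemma alternating_subset: "s \<in> S \<Longrightarrow> t \<in> S \<Longrightarrow> set (alternating s t k) \<subseteq> S"
  using set_alternating[of s t k] by auto

lemma eval_alternating_double:
  "s \<in> S \<Longrightarrow> t \<in> S \<Longrightarrow> eval (alternating s t (2 * k)) = (g s \<otimes> g t) [^] k"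
proof (induction k)
  case (Suc k)
  then have "(g s \<otimes> g t) [^] Suc k = g s \<otimes> g t \<otimes> (g s \<otimes> g t) [^] k"
    by (simp only: nat_pow_Suc2 m_closed gen_closed)
  with Suc show ?case by (simp add: m_assoc del: nat_pow_Suc)
qed simp

text \<open>The braid form of the relation \<open>(g s \<otimes> g t)\<^sup>k = \<one>\<close>.\<close>

lemma eval_alternating_swap:
  assumes "s \<in> S" "t \<in> S" "(g s \<otimes> g t) [^] (k::nat) = \<one>"
  shows "eval (alternating s t k) = eval (alternating t s k)"
proof -
  let ?x = "eval (alternating s t k)" and ?y = "eval (alternating t s k)"
    and ?z = "eval (rev (alternating t s k))"
  note L = alternating_subset[OF assms(1,2), of k] alternating_subset[OF assms(2,1), of k]
  have "?x \<otimes> ?z = \<one>"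
    using eval_alternating_double[OF assms(1,2), of k] assms(3) L
      eval_append[of "alternating s t k" "rev (alternating t s k)"]
    by (simp add: alternating_double )
  moreover have "?y \<otimes> ?z = \<one>" using L by (simp add: eval_rev)
  ultimately show ?thesis using L by (metis right_cancel eval_closed set_rev)
qed

end


section \<open>Freeness on a chamber point\<close>

text \<open>A group generated by involutions that acts on a set, together with a half-space \<open>Pos s\<close> for
  every generator \<open>s\<close>. The point \<open>p\<close> lies in all half-spaces. The decisive axiom
  \<open>Pos_alternating\<close> speaks of two generators only: a point in the half-spaces of \<open>s\<close> and \<open>t\<close> stays
  in that of \<open>s\<close> when an alternating product of fewer than \<open>M s t\<close> factors that begins with \<open>t\<close> is
  applied to it.\<close>

locale chamber_action = involution_generated G S g
  for G (structure) and S :: "'s set" and g :: "'s \<Rightarrow> 'a" +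
  fixes M :: "'s \<Rightarrow> 's \<Rightarrow> nat" and act :: "'a \<Rightarrow> 'x \<Rightarrow> 'x" and Pos :: "'s \<Rightarrow> 'x \<Rightarrow> bool" and p :: 'x
  assumes relation: "s \<in> S \<Longrightarrow> t \<in> S \<Longrightarrow> (g s \<otimes> g t) [^] M s t = \<one>"
    and M_pos: "s \<in> S \<Longrightarrow> t \<in> S \<Longrightarrow> M s t > 0"
    and act_one: "act \<one> x = x"
    and act_mult: "v \<in> carrier G \<Longrightarrow> w \<in> carrier G \<Longrightarrow> act (v \<otimes> w) x = act v (act w x)"
    and Pos_reflect: "s \<in> S \<Longrightarrow> Pos s x \<Longrightarrow> \<not> Pos s (act (g s) x)"
    and Pos_base: "s \<in> S \<Longrightarrow> Pos s p"
    and Pos_alternating: "s \<in> S \<Longrightarrow> t \<in> S \<Longrightarrow> s \<noteq> t \<Longrightarrow> Pos s x \<Longrightarrow> Pos t x \<Longrightarrow> q < M s t \<Longrightarrow>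
      Pos s (act (eval (alternating t s q)) x)"
begin

text \<open>Tits's theorem: if multiplication by \<open>s\<close> does not shorten \<open>w\<close>, then \<open>w\<close> keeps the base
  point in the half-space of \<open>s\<close>.\<close>

lemma Pos_of_ascent:
  "w \<in> carrier G \<Longrightarrow> s \<in> S \<Longrightarrow> len w \<le> len (g s \<otimes> w) \<Longrightarrow> Pos s (act w p)"
proof (induction "len w" arbitrary: w s rule: less_induct)
  case less
  note w = less.prems(1) and s = less.prems(2) and asc = less.prems(3)
  show ?case
  proof (cases "len w = 0")
    case True
    with w have "w = \<one>" by (intro len_eq_0)
    with s show ?thesis by (simp add: act_one Pos_base)
  next
    case False
    then obtain t where t: "t \<in> S" and desc: "Suc (len (g t \<otimes> w)) = len w"
      using len_pos_descent[OF w] by auto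
    have st: "s \<noteq> t" using asc desc by auto
    note alt = alternating_subset[OF t s]
    \<comment> \<open>Split off the longest alternating prefix \<open>t, s, t, \<dots>\<close> that a reduced word for \<open>w\<close> can have.\<close>
    define P where
      "P q \<longleftrightarrow> (\<exists>v \<in> carrier G. w = eval (alternating t s q) \<otimes> v \<and> q + len v = len w)" for q
    have P1: "P 1"
      unfolding P_def using t w desc by (intro bexI[of _ "g t \<otimes> w"]) auto
    have bound: "\<forall>q. P q \<longrightarrow> q \<le> len w" by (auto simp: P_def)
    define q where "q = (GREATEST q. P q)"
    have "P q" unfolding q_def using P1 bound by (blast intro: GreatestI_nat)
    then obtain v where v: "v \<in> carrier G" and wv: "w = eval (alternating t s q) \<otimes> v"
      and lv: "q + len v = len w" by (auto simp: P_def)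
    have "1 \<le> q" unfolding q_def using P1 bound by (blast intro: Greatest_le_nat)
    then obtain q' where q': "q = Suc q'" by (cases q) auto
    have notP: "\<not> P (Suc q)"
      using Greatest_le_nat[of P "Suc q" "len w"] bound unfolding q_def[symmetric] by auto
    define r where "r = (if even q then t else s)"
    define r' where "r' = (if even q then s else t)"
    have rS: "r \<in> S" "r' \<in> S" using s t by (auto simp: r_def r'_def)
    have r_ext: "alternating t s (Suc q) = alternating t s q @ [r]"
      by (simp only: alternating_Suc_snoc r_def)
    have r'_last: "alternating t s q = alternating t s q' @ [r']"
      unfolding q' by (simp only: alternating_Suc_snoc r'_def q') simp
    \<comment> \<open>\<open>r\<close> would be the next letter of the prefix, \<open>r'\<close> is its last one. Neither of them shortens
      the remaining factor \<open>v\<close>: for \<open>r\<close> by maximality of the prefix, for \<open>r'\<close> because the word is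
      reduced.\<close>
    have asc_r: "len v \<le> len (g r \<otimes> v)"
    proof (rule ccontr)
      assume "\<not> ?thesis"
      then have "Suc (len (g r \<otimes> v)) = len v" using len_gen_le[OF rS(1) v] by simp
      moreover have "w = eval (alternating t s (Suc q)) \<otimes> (g r \<otimes> v)"
        unfolding r_ext using rS v alt wv by (simp add: eval_append m_assoc)
      ultimately have "P (Suc q)"
        unfolding P_def using rS v lv by (intro bexI[of _ "g r \<otimes> v"]) auto
      with notP show False ..
    qed
    have asc_r': "len v \<le> len (g r' \<otimes> v)"
    proof -
      have "w = eval (alternating t s q') \<otimes> (g r' \<otimes> v)"
        using wv rS v alt by (simp add: r'_last eval_append m_assoc)
      then have "len w \<le> q' + len (g r' \<otimes> v)"
        using len_mult_eval_le[OF alt[of q'], of "g r' \<otimes> v"] rS v by simp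
      then show ?thesis using lv q' by simp
    qed
    have "Pos r (act v p)" "Pos r' (act v p)"
      using less.hyps[of v] v rS asc_r asc_r' lv q' by auto
    then have pos: "Pos s (act v p)" "Pos t (act v p)"
      by (auto simp: r_def r'_def split: if_splits)
    have "q < M s t"
    proof (rule ccontr)
      assume "\<not> ?thesis"
      then obtain j where j: "q = M s t + j" using le_Suc_ex not_less by blast
      obtain m where m: "M s t = Suc m" using M_pos[OF s t] by (cases "M s t") auto
      \<comment> \<open>The braid relation would give \<open>w\<close> a reduced word that begins with \<open>s\<close>.\<close>
      have swap: "eval (alternating t s (M s t)) = eval (alternating s t (M s t))"
        using eval_alternating_swap[OF s t relation[OF s t]] by simp
      obtain us where us: "set us \<subseteq> S" "length us = j"
        "alternating t s q = alternating t s (M s t) @ us"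
        unfolding j alternating_add
        using alternating_subset[OF s t, of j] alt[of j] by (cases "even (M s t)") auto
      have "eval (alternating t s q) = eval (alternating s t (M s t)) \<otimes> eval us"
        unfolding us(3) using us(1) alt swap by (simp add: eval_append)
      also have "\<dots> = g s \<otimes> eval (alternating t s m @ us)"
        using us(1) alt s by (simp add: eval_append m m_assoc)
      finally have "eval (alternating t s q) = g s \<otimes> eval (alternating t s m @ us)" .
      then have "g s \<otimes> w = eval (alternating t s m @ us) \<otimes> v"
        using wv us alt s v by (simp add: m_assoc)
      then have "len (g s \<otimes> w) \<le> m + j + len v"
        using len_mult_eval_le[of "alternating t s m @ us" v] us alt v by simp
      then show False using asc lv j m by simp
    qed
    then show ?thesis
      using Pos_alternating[OF s t st pos] wv alt v by (simp add: act_mult)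
  qed
qed

lemma stabilizer_trivial:
  assumes w: "w \<in> carrier G" and fixed: "act w p = p"
  shows "w = \<one>"
proof (rule ccontr)
  assume "w \<noteq> \<one>"
  then have "len w > 0" using len_eq_0[OF w] by auto
  then obtain s where s: "s \<in> S" "Suc (len (g s \<otimes> w)) = len w"
    using len_pos_descent[OF w] by auto
  then have "Pos s (act (g s \<otimes> w) p)"
    using Pos_of_ascent[of "g s \<otimes> w" s] w by simp
  then have "\<not> Pos s (act (g s) (act (g s \<otimes> w) p))" using s Pos_reflect by blast
  moreover have "act (g s) (act (g s \<otimes> w) p) = act w p"
    using s w by (simp flip: act_mult)
  ultimately show False using fixed s Pos_base by simp
qed

end


section \<open>Coxeter groups acting by affine reflections\<close>

text \<open>The reflection with root vector \<open>v\<close> in the hyperplane \<open>\<alpha> = 0\<close>, on real vectors indexed by \<open>'i\<close>.\<close>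

definition reflection :: "(('i \<Rightarrow> real) \<Rightarrow> real) \<Rightarrow> ('i \<Rightarrow> real) \<Rightarrow> ('i \<Rightarrow> real) \<Rightarrow> 'i \<Rightarrow> real" where
  "reflection \<alpha> v x = (\<lambda>i. x i - \<alpha> x * v i)"

text \<open>The triples that the order \<open>m\<close> of the product of two reflections and the two off-diagonal
  Cartan integers (with the sign reversed) may form.\<close>

definition cartan_bond :: "nat \<Rightarrow> real \<Rightarrow> real \<Rightarrow> bool" where
  "cartan_bond m c d \<longleftrightarrow> (m, c, d) \<in> {(2, 0, 0), (3, 1, 1), (4, 1, 2), (4, 2, 1)}"

text \<open>A Coxeter matrix \<open>M\<close> realized by reflections. Of the functions \<open>\<alpha> s\<close>, thought of as
  affine, only the effect of the reflections on them matters. The point \<open>p\<close> lies in the open chamber where all \<open>\<alpha> s\<close> are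
  positive.\<close>

locale reflection_datum =
  fixes S :: "'s set" and M :: "'s \<Rightarrow> 's \<Rightarrow> nat"
    and \<alpha> :: "'s \<Rightarrow> ('i \<Rightarrow> real) \<Rightarrow> real" and v :: "'s \<Rightarrow> 'i \<Rightarrow> real" and p :: "'i \<Rightarrow> real"
  assumes M_diag: "s \<in> S \<Longrightarrow> M s s = 1"
    and wall_self: "s \<in> S \<Longrightarrow> \<alpha> s (reflection (\<alpha> s) (v s) x) = - \<alpha> s x"
    and bond: "s \<in> S \<Longrightarrow> t \<in> S \<Longrightarrow> s \<noteq> t \<Longrightarrow> \<exists>c d. cartan_bond (M s t) c d \<and>
      (\<forall>x. \<alpha> s (reflection (\<alpha> t) (v t) x) = \<alpha> s x + c * \<alpha> t x) \<and>
      (\<forall>x. \<alpha> t (reflection (\<alpha> s) (v s) x) = \<alpha> t x + d * \<alpha> s x)"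
    and base: "s \<in> S \<Longrightarrow> \<alpha> s p > 0"
begin

abbreviation refl :: "'s \<Rightarrow> ('i \<Rightarrow> real) \<Rightarrow> 'i \<Rightarrow> real" where
  "refl s \<equiv> reflection (\<alpha> s) (v s)"

abbreviation Maps :: "(('i \<Rightarrow> real) \<Rightarrow> 'i \<Rightarrow> real) monoid" where
  "Maps \<equiv> BijGroup UNIV"

text \<open>The reflection representation of the Coxeter group.\<close>

definition rep :: "'s word set \<Rightarrow> ('i \<Rightarrow> real) \<Rightarrow> 'i \<Rightarrow> real" where
  "rep = pres_lift Maps refl"

lemma refl_refl: "s \<in> S \<Longrightarrow> refl s (refl s x) = x"
  using wall_self[of s x] by (simp add: reflection_def)

lemma refl_closed: "s \<in> S \<Longrightarrow> refl s \<in> carrier Maps"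
  by (auto simp: BijGroup_def Bij_def refl_refl intro!: o_bij[of "refl s"])

lemma Maps_mult: "f \<in> carrier Maps \<Longrightarrow> h \<in> carrier Maps \<Longrightarrow> (f \<otimes>\<^bsub>Maps\<^esub> h) x = f (h x)"
  by (simp add: BijGroup_def compose_def)

lemma Maps_one: "\<one>\<^bsub>Maps\<^esub> x = x"
  by (simp add: BijGroup_def)

lemma refl_relation:
  assumes s: "s \<in> S" and t: "t \<in> S"
  shows "(refl s \<otimes>\<^bsub>Maps\<^esub> refl t) [^]\<^bsub>Maps\<^esub> M s t = \<one>\<^bsub>Maps\<^esub>"
proof -
  interpret H: group Maps by (rule group_BijGroup)
  note cl = refl_closed[OF s] refl_closed[OF t]
  have one: "f = \<one>\<^bsub>Maps\<^esub>" if "\<And>x. f x = x" for f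
    using that by (auto simp: BijGroup_def)
  show ?thesis
  proof (cases "s = t")
    case True
    with s show ?thesis
      by (intro one) (simp add: M_diag Maps_mult refl_closed refl_refl)
  next
    case False
    obtain c d where cd: "cartan_bond (M s t) c d"
      and st: "\<And>x. \<alpha> s (refl t x) = \<alpha> s x + c * \<alpha> t x"
      and ts: "\<And>x. \<alpha> t (refl s x) = \<alpha> t x + d * \<alpha> s x"
      using bond[OF s t False] by blast
    define T where "T y = refl s (refl t y)" for y
    have T_power: "((refl s \<otimes>\<^bsub>Maps\<^esub> refl t) [^]\<^bsub>Maps\<^esub> k) x = (T ^^ k) x" for k :: nat and x
      using cl by (induction k arbitrary: x)
        (simp_all add: T_def Maps_mult Maps_one funpow_Suc_right del: funpow.simps(2))
    \<comment> \<open>The values \<open>\<alpha> s\<close> and \<open>\<alpha> t\<close> change linearly under \<open>T\<close>, and only they enter the displacement.\<close>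
    have sT: "\<alpha> s (T y) = - \<alpha> s y - c * \<alpha> t y" for y
      by (simp add: T_def st wall_self[OF s])
    have tT: "\<alpha> t (T y) = d * \<alpha> s y + (d * c - 1) * \<alpha> t y" for y
      by (simp add: T_def st ts wall_self[OF t] algebra_simps)
    have Ti: "T y i = y i - \<alpha> t y * v t i - (\<alpha> s y + c * \<alpha> t y) * v s i" for y i
      unfolding T_def by (simp add: reflection_def st[unfolded reflection_def])
    have "(T ^^ M s t) x i = x i" for x i
    proof -
      consider "M s t = 2" "c = 0" "d = 0" | "M s t = 3" "c = 1" "d = 1"
        | "M s t = 4" "c = 1" "d = 2" | "M s t = 4" "c = 2" "d = 1"
        using cd by (auto simp: cartan_bond_def)
      then show ?thesis
        by cases (simp_all only: eval_nat_numeral BitM.simps funpow.simps comp_apply id_apply Ti sT tT,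
          simp_all add: algebra_simps)
    qed
    with T_power show ?thesis by (intro one ext) simp
  qed
qed

lemma relator_trivial:
  "r \<in> coxeter_relators S M \<Longrightarrow> word_eval Maps refl r = \<one>\<^bsub>Maps\<^esub>"
  using refl_closed refl_relation
  by (intro coxeter_relators_eval[of _ _ S M] group_BijGroup) auto

lemma rep_hom: "rep \<in> hom (coxeter_group S M) Maps"
  unfolding rep_def coxeter_group_def
  using refl_closed relator_trivial by (intro pres_lift_hom group_BijGroup) auto

lemma rep_gen: "s \<in> S \<Longrightarrow> rep (coxeter_gen S M s) = refl s"
  unfolding rep_def coxeter_gen_def
  using refl_closed relator_trivial by (intro pres_lift_gen group_BijGroup) auto

lemma coxeter_involution_generated:
  "involution_generated (coxeter_group S M) S (coxeter_gen S M)"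
proof -
  let ?G = "coxeter_group S M" and ?g = "coxeter_gen S M" and ?R = "coxeter_relators S M"
  interpret group ?G by (rule group_coxeter_group)
  show ?thesis
  proof
    fix s assume s: "s \<in> S"
    show "?g s \<in> carrier ?G" using s by (rule coxeter_gen_closed)
    with s coxeter_gen_relation[of s S s M] show "?g s \<otimes>\<^bsub>?G\<^esub> ?g s = \<one>\<^bsub>?G\<^esub>"
      by (simp add: M_diag)
  next
    fix w assume "w \<in> carrier ?G"
    then obtain u where u: "u \<in> words S" "w = pres_rel S ?R `` {u}"
      unfolding coxeter_group_def by (rule presented_group_carrier_cases)
    have "pres_rel S ?R `` {u} = foldr (\<lambda>s. (\<otimes>\<^bsub>?G\<^esub>) (?g s)) (map snd u) \<one>\<^bsub>?G\<^esub>"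
      using u(1)
    proof (induction u)
      case Nil
      then show ?case by (simp add: coxeter_group_def presented_group_one)
    next
      case (Cons x u)
      obtain e s where x: "x = (e, s)" by force
      with Cons.prems have s: "s \<in> S" and u: "u \<in> words S" by auto
      have cl: "?g s \<in> carrier ?G" using s by (rule coxeter_gen_closed)
      \<comment> \<open>Formal inverses may be dropped since the generators are involutions.\<close>
      have "pres_rel S ?R `` {[(False, s)]} = ?g s"
      proof -
        have cl': "pres_rel S ?R `` {[(False, s)]} \<in> carrier ?G"
          using s by (simp add: coxeter_group_def presented_group_class_closed)
        have "pres_eq S ?R ([] @ [(False, s), (\<not> False, s)] @ []) ([] @ [])"
          using s by (intro pres_eq.cancel) auto
        then have "pres_rel S ?R `` {[(False, s)]} \<otimes>\<^bsub>?G\<^esub> ?g s = \<one>\<^bsub>?G\<^esub>"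
          using s by (simp add: coxeter_group_def coxeter_gen_def pres_gen_def
              presented_group_mult_class presented_group_one pres_class_eq_iff)
        moreover have "?g s \<otimes>\<^bsub>?G\<^esub> ?g s = \<one>\<^bsub>?G\<^esub>"
          using s cl coxeter_gen_relation[of s S s M] by (simp add: M_diag)
        ultimately show ?thesis using cl cl' by (metis right_cancel)
      qed
      then have "pres_rel S ?R `` {[x]} = ?g s"
        by (cases e) (simp_all add: x coxeter_gen_def pres_gen_def)
      moreover have "pres_rel S ?R `` {[x] @ u} =
          pres_rel S ?R `` {[x]} \<otimes>\<^bsub>?G\<^esub> pres_rel S ?R `` {u}"
        using s u x presented_group_mult_class[of "[x]" S u ?R] by (simp add: coxeter_group_def)
      ultimately show ?case using Cons.IH[OF u] by (simp add: x)
    qed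
    moreover have "set (map snd u) \<subseteq> S"
      using u(1) by (induction u) auto
    ultimately show "\<exists>us. set us \<subseteq> S \<and> w = foldr (\<lambda>s. (\<otimes>\<^bsub>?G\<^esub>) (?g s)) us \<one>\<^bsub>?G\<^esub>"
      using u(2) by blast
  qed
qed

text \<open>The computation in a dihedral group of order at most 8: the functions that \<open>\<alpha> s\<close> becomes
  under the alternating products are \<open>\<alpha> s\<close>, \<open>\<alpha> t\<close> or sums of the two with nonnegative coefficients.\<close>

lemma wall_alternating_pos:
  assumes s: "s \<in> S" and t: "t \<in> S" and "s \<noteq> t" and x: "\<alpha> s x > 0" "\<alpha> t x > 0"
    and q: "q < M s t"
  shows "\<alpha> s (foldr refl (alternating t s q) x) > 0"
proof -
  obtain c d where cd: "cartan_bond (M s t) c d"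
    and st: "\<And>x. \<alpha> s (refl t x) = \<alpha> s x + c * \<alpha> t x"
    and ts: "\<And>x. \<alpha> t (refl s x) = \<alpha> t x + d * \<alpha> s x"
    using bond[OF s t \<open>s \<noteq> t\<close>] by blast
  note * = st ts wall_self[OF s] wall_self[OF t]
  have "q = 0 \<or> q = 1 \<or> q = 2 \<or> q = 3"
    using q cd by (auto simp: cartan_bond_def)
  then show ?thesis
    using x q cd unfolding cartan_bond_def
    by (elim disjE insertE) (simp_all add: eval_nat_numeral *)
qed

theorem rep_inj: "inj_on rep (carrier (coxeter_group S M))"
proof -
  let ?G = "coxeter_group S M"
  interpret involution_generated ?G S "coxeter_gen S M"
    by (rule coxeter_involution_generated)
  interpret H: group Maps by (rule group_BijGroup)
  interpret rep: group_hom ?G Maps rep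
    using rep_hom by unfold_locales
  have act_mult: "rep (a \<otimes>\<^bsub>?G\<^esub> b) x = rep a (rep b x)"
    if "a \<in> carrier ?G" "b \<in> carrier ?G" for a b x
    using that by (simp add: Maps_mult)
  have act_one: "rep \<one>\<^bsub>?G\<^esub> x = x" for x
    by (simp add: Maps_one)
  have act_eval: "rep (eval us) x = foldr refl us x" if "set us \<subseteq> S" for us x
    using that by (induction us) (simp_all add: act_one act_mult rep_gen del: rep.hom_mult rep.hom_one)
  interpret chamber_action ?G S "coxeter_gen S M" M rep "\<lambda>s x. \<alpha> s x > 0" p
  proof
    fix s t assume "s \<in> S" "t \<in> S"
    then show "M s t > 0"
      using M_diag[of s] bond[of s t] by (cases "s = t") (auto simp: cartan_bond_def)
  next
    fix s t x q
    assume "s \<in> S" "t \<in> S" "s \<noteq> t" "\<alpha> s x > 0" "\<alpha> t x > 0" "q < M s t"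
    then show "\<alpha> s (rep (eval (alternating t s q)) x) > 0"
      using wall_alternating_pos by (simp add: act_eval alternating_subset)
  qed (auto simp: coxeter_gen_relation act_one act_mult rep_gen wall_self base
      simp del: rep.hom_mult rep.hom_one)
  show ?thesis
    unfolding rep.inj_on_one_iff
    using stabilizer_trivial by (auto simp: Maps_one)
qed

text \<open>A homomorphism of \<open>coxeter_group S M\<close> is injective as soon as the reflection representation
  factors through it.\<close>

lemma hom_inj_of_rep_factor:
  assumes h: "h \<in> hom (coxeter_group S M) K" and k: "k \<in> hom K Maps"
    and hk: "\<And>s. s \<in> S \<Longrightarrow> k (h (coxeter_gen S M s)) = refl s"
  shows "inj_on h (carrier (coxeter_group S M))"
proof -
  have "k \<circ> h \<in> hom (coxeter_group S M) Maps" using h k by (rule hom_compose)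
  then have "(k \<circ> h) X = rep X" if "X \<in> carrier (coxeter_group S M)" for X
    using that hk relator_trivial refl_closed unfolding rep_def coxeter_group_def coxeter_gen_def
    by (intro pres_lift_unique[where S = S and R = "coxeter_relators S M"] group_BijGroup)
      (auto simp del: comp_apply simp: comp_apply[of k h "pres_gen S R s" for R s])
  then have "inj_on (k \<circ> h) (carrier (coxeter_group S M))"
    using rep_inj by (simp cong: inj_on_cong)
  then show ?thesis by (rule inj_on_imageI2)
qed

end


section \<open>The affine types B and D\<close>

text \<open>The walls of the fundamental alcove, as affine functions of infinitely many coordinates, of
  which rank \<open>m\<close> only moves those with index \<open>1, \<dots>, m\<close>. The wall of \<open>SigBar 1\<close> is the affine one.\<close>

fun wall :: "label \<Rightarrow> (nat \<Rightarrow> real) \<Rightarrow> real" where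
  "wall (Sig i) x = x i - x (Suc i)"
| "wall (SigBar i) x = (if i = 1 then 1 - x 1 - x 2 else x i + x (Suc i))"
| "wall (Tee m) x = x m"

text \<open>The root vectors, scaled so that reflecting in a wall changes the sign of its function.\<close>

fun coroot :: "label \<Rightarrow> nat \<Rightarrow> real" where
  "coroot (Sig i) = (\<lambda>_. 0)(i := 1, Suc i := -1)"
| "coroot (SigBar i) = (if i = 1 then (\<lambda>_. 0)(1 := -1, 2 := -1) else (\<lambda>_. 0)(i := 1, Suc i := 1))"
| "coroot (Tee m) = (\<lambda>_. 0)(m := 2)"

text \<open>A point in the interior of the alcoves of all ranks: its coordinates are positive and
  decreasing, and those with index 1 and 2 add up to \<open>5/6 < 1\<close>.\<close>

definition alcove_point :: "nat \<Rightarrow> real" where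
  "alcove_point i = 1 / (real i + 1)"

lemma wall_alcove_point: "wall s alcove_point > 0"
  by (cases s) (auto simp: alcove_point_def field_simps intro!: add_pos_nonneg divide_pos_pos)

lemma wall_reflection_self: "wall s (reflection (wall s) (coroot s) x) = - wall s x"
  by (cases s) (auto simp: reflection_def)

text \<open>The part of \<open>reflection_datum.bond\<close> that concerns one unordered pair of labels.\<close>

definition wall_bond :: "nat \<Rightarrow> label \<Rightarrow> label \<Rightarrow> bool" where
  "wall_bond m s t \<longleftrightarrow> (\<exists>c d. cartan_bond m c d \<and>
      (\<forall>x. wall s (reflection (wall t) (coroot t) x) = wall s x + c * wall t x) \<and>
      (\<forall>x. wall t (reflection (wall s) (coroot s) x) = wall t x + d * wall s x))"

lemma cartan_bond_sym: "cartan_bond m c d \<Longrightarrow> cartan_bond m d c"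
  by (auto simp: cartan_bond_def)

lemma wall_bond_sym: "wall_bond m s t \<Longrightarrow> wall_bond m t s"
  unfolding wall_bond_def using cartan_bond_sym by blast

lemma wall_bond_2:
  assumes "\<And>x. wall s (reflection (wall t) (coroot t) x) = wall s x"
    and "\<And>x. wall t (reflection (wall s) (coroot s) x) = wall t x"
  shows "wall_bond 2 s t"
  unfolding wall_bond_def cartan_bond_def using assms by (intro exI[of _ 0]) auto

lemma wall_bond_3:
  assumes "\<And>x. wall s (reflection (wall t) (coroot t) x) = wall s x + wall t x"
    and "\<And>x. wall t (reflection (wall s) (coroot s) x) = wall t x + wall s x"
  shows "wall_bond 3 s t"
  unfolding wall_bond_def cartan_bond_def using assms by (intro exI[of _ 1]) auto

lemma wall_bond_4:
  assumes "\<And>x. wall s (reflection (wall t) (coroot t) x) = wall s x + 2 * wall t x"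
    and "\<And>x. wall t (reflection (wall s) (coroot s) x) = wall t x + wall s x"
  shows "wall_bond 4 s t"
  unfolding wall_bond_def cartan_bond_def using assms by (intro exI[of _ 2] exI[of _ 1]) auto

lemma wall_bond_Sig_Suc: "wall_bond 3 (Sig i) (Sig (Suc i))"
  by (rule wall_bond_3) (auto simp: reflection_def)

lemma wall_bond_Sig_Sig: "Suc i < j \<Longrightarrow> wall_bond 2 (Sig i) (Sig j)"
  by (rule wall_bond_2) (auto simp: reflection_def)

lemma wall_bond_SigBar1_Sig: "1 \<le> i \<Longrightarrow> wall_bond (if i = 2 then 3 else 2) (SigBar 1) (Sig i)"
  by (cases "i = 2"; simp; intro wall_bond_2 wall_bond_3) (auto simp: reflection_def numeral_2_eq_2)

lemma wall_bond_Sig_Tee: "1 \<le> i \<Longrightarrow> i < m \<Longrightarrow> wall_bond (if Suc i = m then 4 else 2) (Sig i) (Tee m)"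
  by (cases "Suc i = m"; simp; intro wall_bond_2 wall_bond_4) (auto simp: reflection_def)

lemma wall_bond_SigBar1_Tee: "3 \<le> m \<Longrightarrow> wall_bond 2 (SigBar 1) (Tee m)"
  by (rule wall_bond_2) (auto simp: reflection_def)

lemma wall_bond_Sig_SigBar:
  "2 \<le> k \<Longrightarrow> 1 \<le> i \<Longrightarrow> i \<le> k \<Longrightarrow> wall_bond (if Suc i = k then 3 else 2) (Sig i) (SigBar k)"
  by (cases "Suc i = k"; simp; intro wall_bond_2 wall_bond_3) (auto simp: reflection_def)

lemma wall_bond_SigBar1_SigBar: "3 \<le> k \<Longrightarrow> wall_bond 2 (SigBar 1) (SigBar k)"
  by (rule wall_bond_2) (auto simp: reflection_def)

lemma B_matrix_wall_bond:
  assumes n: "n \<ge> 3" and st: "s \<in> B_labels n" "t \<in> B_labels n" "s \<noteq> t"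
  shows "wall_bond (B_matrix n s t) s t"
proof -
  define Q where "Q a b \<longleftrightarrow> wall_bond (B_matrix n a b) a b" for a b
  have Q_sym: "Q b a" if "Q a b" for a b
    using that by (simp add: Q_def wall_bond_sym B_matrix_sym[of n b])
  have SS: "Q (Sig i) (Sig j)" if "1 \<le> i" "i < j" "j < n" for i j
  proof (cases "j = Suc i")
    case True
    then have "B_matrix n (Sig i) (Sig j) = 3"
      using that by (auto simp: B_matrix_def doubleton_eq_iff)
    with True show ?thesis by (simp add: Q_def wall_bond_Sig_Suc)
  next
    case False
    then have "B_matrix n (Sig i) (Sig j) = 2"
      using that by (auto simp: B_matrix_def doubleton_eq_iff)
    with that False show ?thesis by (simp add: Q_def wall_bond_Sig_Sig)
  qed
  have SS': "Q (Sig i) (Sig j)" if "1 \<le> i" "i < n" "1 \<le> j" "j < n" "i \<noteq> j" for i j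
    using that SS[of i j] SS[of j i, THEN Q_sym] by (cases "i < j") auto
  have BS: "Q (SigBar 1) (Sig i)" if "1 \<le> i" "i < n" for i
  proof -
    have "B_matrix n (SigBar 1) (Sig i) = (if i = 2 then 3 else 2)"
      by (auto simp: B_matrix_def doubleton_eq_iff)
    with that wall_bond_SigBar1_Sig[of i] show ?thesis by (simp add: Q_def)
  qed
  have ST: "Q (Sig i) (Tee n)" if "1 \<le> i" "i < n" for i
  proof -
    have "B_matrix n (Sig i) (Tee n) = (if Suc i = n then 4 else 2)"
      using that by (auto simp: B_matrix_def doubleton_eq_iff)
    with that wall_bond_Sig_Tee[of i n] show ?thesis by (simp add: Q_def)
  qed
  have BT: "Q (SigBar 1) (Tee n)"
  proof -
    have "B_matrix n (SigBar 1) (Tee n) = 2"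
      by (auto simp: B_matrix_def doubleton_eq_iff)
    with n wall_bond_SigBar1_Tee[of n] show ?thesis by (simp add: Q_def)
  qed
  have "Q s t"
    using n st BS ST BT BS[THEN Q_sym] ST[THEN Q_sym] BT[THEN Q_sym]
    by (auto simp: B_labels_def intro!: SS')
  then show ?thesis by (simp add: Q_def)
qed

lemma D_matrix_wall_bond:
  assumes n: "n \<ge> 4" and st: "s \<in> D_labels n" "t \<in> D_labels n" "s \<noteq> t"
  shows "wall_bond (D_matrix n s t) s t"
proof -
  define Q where "Q a b \<longleftrightarrow> wall_bond (D_matrix n a b) a b" for a b
  have Q_sym: "Q b a" if "Q a b" for a b
    using that by (simp add: Q_def wall_bond_sym D_matrix_sym[of n b])
  have SS: "Q (Sig i) (Sig j)" if "1 \<le> i" "i < j" "j < n" for i j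
  proof (cases "j = Suc i")
    case True
    then have "D_matrix n (Sig i) (Sig j) = 3"
      using that by (auto simp: D_matrix_def doubleton_eq_iff)
    with True show ?thesis by (simp add: Q_def wall_bond_Sig_Suc)
  next
    case False
    then have "D_matrix n (Sig i) (Sig j) = 2"
      using that by (auto simp: D_matrix_def doubleton_eq_iff)
    with that False show ?thesis by (simp add: Q_def wall_bond_Sig_Sig)
  qed
  have SS': "Q (Sig i) (Sig j)" if "1 \<le> i" "i < n" "1 \<le> j" "j < n" "i \<noteq> j" for i j
    using that SS[of i j] SS[of j i, THEN Q_sym] by (cases "i < j") auto
  have BS: "Q (SigBar 1) (Sig i)" if "1 \<le> i" "i < n" for i
  proof -
    have "D_matrix n (SigBar 1) (Sig i) = (if i = 2 then 3 else 2)"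
      using n by (auto simp: D_matrix_def doubleton_eq_iff)
    with that wall_bond_SigBar1_Sig[of i] show ?thesis by (simp add: Q_def)
  qed
  have ST: "Q (Sig i) (SigBar (n - 1))" if "1 \<le> i" "i < n" for i
  proof -
    have "D_matrix n (Sig i) (SigBar (n - 1)) = (if Suc i = n - 1 then 3 else 2)"
      using n that by (auto simp: D_matrix_def doubleton_eq_iff)
    with n that wall_bond_Sig_SigBar[of "n - 1" i] show ?thesis by (simp add: Q_def)
  qed
  have BT: "Q (SigBar 1) (SigBar (n - 1))"
  proof -
    have "D_matrix n (SigBar 1) (SigBar (n - 1)) = 2"
      using n by (auto simp: D_matrix_def doubleton_eq_iff)
    with n wall_bond_SigBar1_SigBar[of "n - 1"] show ?thesis by (simp add: Q_def)
  qed
  have "Q s t"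
    using n st BS ST BT BS[THEN Q_sym] ST[THEN Q_sym] BT[THEN Q_sym]
    by (auto simp: D_labels_def intro!: SS')
  then show ?thesis by (simp add: Q_def)
qed

lemma reflection_datum_B:
  assumes "n \<ge> 3"
  shows "reflection_datum (B_labels n) (B_matrix n) wall coroot alcove_point"
  using B_matrix_wall_bond[OF assms]
  by unfold_locales
     (auto simp: B_matrix_def wall_reflection_self wall_alcove_point wall_bond_def)

lemma reflection_datum_D:
  assumes "n \<ge> 4"
  shows "reflection_datum (D_labels n) (D_matrix n) wall coroot alcove_point"
  using D_matrix_wall_bond[OF assms]
  by unfold_locales
     (auto simp: D_matrix_def wall_reflection_self wall_alcove_point wall_bond_def)

text \<open>The images of the last generators, seen in the geometric action.\<close>

lemma reflection_Tee_conj: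
  "reflection (wall (Sig n)) (coroot (Sig n)) (reflection (wall (Tee (Suc n))) (coroot (Tee (Suc n)))
     (reflection (wall (Sig n)) (coroot (Sig n)) x)) = reflection (wall (Tee n)) (coroot (Tee n)) x"
  by (auto simp: reflection_def)

lemma reflection_SigBar_conj:
  assumes "n \<ge> 3"
  shows "reflection (wall (Sig n)) (coroot (Sig n)) (reflection (wall (Sig (n - 1))) (coroot (Sig (n - 1)))
     (reflection (wall (SigBar n)) (coroot (SigBar n))
     (reflection (wall (Sig (n - 1))) (coroot (Sig (n - 1))) (reflection (wall (Sig n)) (coroot (Sig n)) x))))
     = reflection (wall (SigBar (n - 1))) (coroot (SigBar (n - 1))) x"
proof -
  obtain k where "n = Suc k" "k \<ge> 2" using assms by (cases n) auto
  then show ?thesis by (auto simp: reflection_def)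
qed

lemma L_map_inj:
  assumes n: "n \<ge> 3"
  shows "inj_on (L_map n) (carrier (W_B n))"
proof -
  let ?G = "W_B (Suc n)"
  interpret B: reflection_datum "B_labels n" "B_matrix n" wall coroot alcove_point
    using n by (rule reflection_datum_B)
  interpret B': reflection_datum "B_labels (Suc n)" "B_matrix (Suc n)" wall coroot alcove_point
    using n by (intro reflection_datum_B) simp
  interpret G: group ?G by (rule group_W_B)
  interpret H: group B'.Maps by (rule group_BijGroup)
  interpret rep: group_hom ?G B'.Maps B'.rep
    using B'.rep_hom by unfold_locales (simp add: W_B_def)
  have gen: "B'.rep (gen_B (Suc n) s) = reflection (wall s) (coroot s)" if "s \<in> B_labels (Suc n)" for s
    using B'.rep_gen[OF that] by (simp add: gen_B_def)
  have cl: "Sig n \<in> B_labels (Suc n)" "Tee (Suc n) \<in> B_labels (Suc n)"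
    using n by (auto simp: B_labels_def)
  have "B'.rep (L_images n s) = reflection (wall s) (coroot s)" if s: "s \<in> B_labels n" for s
  proof (cases "s = Tee n")
    case True
    have "B'.rep (L_images n s) x = reflection (wall s) (coroot s) x" for x
      unfolding True
      using cl B'.refl_closed[OF cl(1)] B'.refl_closed[OF cl(2)]
      by (simp add: L_images_def gen_B_closed gen B'.Maps_mult reflection_Tee_conj
          del: wall.simps coroot.simps)
    then show ?thesis by blast
  next
    case False
    with s have "s \<in> B_labels (Suc n)" by (auto simp: B_labels_def)
    with False show ?thesis by (simp add: L_images_def gen)
  qed
  then have "B'.rep (L_map n (gen_B n s)) = reflection (wall s) (coroot s)" if "s \<in> B_labels n" for s
    using that n by (simp add: L_map_gen)
  then show ?thesis
    using B.hom_inj_of_rep_factor[of "L_map n" ?G B'.rep] L_map_hom[OF n] rep.homh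
    by (simp add: W_B_def[of n] gen_B_def)
qed

lemma G_map_inj:
  assumes n: "n \<ge> 4"
  shows "inj_on (G_map n) (carrier (W_D n))"
proof -
  let ?G = "W_D (Suc n)"
  interpret D: reflection_datum "D_labels n" "D_matrix n" wall coroot alcove_point
    using n by (rule reflection_datum_D)
  interpret D': reflection_datum "D_labels (Suc n)" "D_matrix (Suc n)" wall coroot alcove_point
    using n by (intro reflection_datum_D) simp
  interpret G: group ?G by (rule group_W_D)
  interpret H: group D'.Maps by (rule group_BijGroup)
  interpret rep: group_hom ?G D'.Maps D'.rep
    using D'.rep_hom by unfold_locales (simp add: W_D_def)
  have gen: "D'.rep (gen_D (Suc n) s) = reflection (wall s) (coroot s)" if "s \<in> D_labels (Suc n)" for s
    using D'.rep_gen[OF that] by (simp add: gen_D_def)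
  have cl: "Sig n \<in> D_labels (Suc n)" "Sig (n - 1) \<in> D_labels (Suc n)" "SigBar n \<in> D_labels (Suc n)"
    using n by (auto simp: D_labels_def)
  have "D'.rep (G_images n s) = reflection (wall s) (coroot s)" if s: "s \<in> D_labels n" for s
  proof (cases "s = SigBar (n - 1)")
    case True
    have "D'.rep (G_images n s) x = reflection (wall s) (coroot s) x" for x
      unfolding True
      using cl n D'.refl_closed[OF cl(1)] D'.refl_closed[OF cl(2)] D'.refl_closed[OF cl(3)]
      by (simp add: G_images_def gen_D_closed gen D'.Maps_mult reflection_SigBar_conj[unfolded One_nat_def]
          del: wall.simps coroot.simps)
    then show ?thesis by blast
  next
    case False
    with s have "s \<in> D_labels (Suc n)" by (auto simp: D_labels_def)
    with False show ?thesis by (simp add: G_images_def gen)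
  qed
  then have "D'.rep (G_map n (gen_D n s)) = reflection (wall s) (coroot s)" if "s \<in> D_labels n" for s
    using that n by (simp add: G_map_gen)
  then show ?thesis
    using D.hom_inj_of_rep_factor[of "G_map n" ?G D'.rep] G_map_hom[OF n] rep.homh
    by (simp add: W_D_def[of n] gen_D_def)
qed

theorem corollary2p2:
  "(\<forall>n\<ge>3. L_map n \<in> hom (W_B n) (W_B (Suc n)) \<and> inj_on (L_map n) (carrier (W_B n))) \<and>
   (\<forall>n\<ge>4. G_map n \<in> hom (W_D n) (W_D (Suc n)) \<and> inj_on (G_map n) (carrier (W_D n)))"
  by (simp add: L_map_hom L_map_inj G_map_hom G_map_inj)

end
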